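(* Let $(X,Y)$ be a productive synchronized pair of finite racks. There exists $N_0$ such that for every $N\ge N_0$ and all $v,w\in S^*_{X\times Y}(N)$ satisfying (i) the projections of $v$ and $w$ to $S_X$ coincide, (ii) the projections of $v$ and $w$ to $S_Y$ coincide, and (iii) for every $t\in X_{\mathrm{triv}}\times Y_{\mathrm{triv}}$ the number of entries of $v$ projecting to $t$ equals the number of entries of $w$ projecting to $t$, we have $v=w$.
   Context: A rack is a set $X$ with an operation $x^y$ such that $x\mapsto x^y$ is bijective for each $y$ and $(z^x)^y=(z^y)^{x^y}$; the product rack has $(x,a)^{(y,b)}=(x^y,a^b)$. Connected components of a rack are the classes of the smallest equivalence relation with $x\sim x^y$; $X_{\mathrm{triv}}$ is the set of components. $\Gamma_X=\langle X\mid y^{-1}xy=x^y\rangle$; $(X,Y)$ is productive if $\Gamma'_{X\times Y}\to\Gamma'_X\times\Gamma'_Y$ (induced on commutator subgroups) is injective, and synchronized if $(X\times Y)_{\mathrm{triv}}\to X_{\mathrm{triv}}\times Y_{\mathrm{triv}}$ is bijective. $B_n$ acts on $Z^n$ ($Z$ a rack) by $(\dots,z_i,z_{i+1},\dots)^{\sigma_i}=(\dots,z_{i+1},z_i^{z_{i+1}},\dots)$; $S_Z=\bigsqcup_{n\ge1}Z^n/B_n$ with concatenation; projections $S_{X\times Y}\to S_X,S_Y$ are induced entrywise. For a finite rack $Z$ with components $C_1,\dots,C_k$, $S^*_Z(N)=\bigcup_{n_1,\dots,n_k\ge N}Z^*(n_1,\dots,n_k)/B_n$, where $Z^*(n_1,\dots,n_k)$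 is the set of tuples with exactly $n_j$ entries in $C_j$ whose entries generate $Z$ (lie in no proper subset closed under the operation). The number of entries of an orbit projecting to a given $t$ is well defined. *)

theory Defs
  imports "HOL-Algebra.Generated_Groups"
begin

text \<open>A rack is a carrier set X with an operation op, where op x y stands for x^y.\<close>

definition rack :: "'a set \<Rightarrow> ('a \<Rightarrow> 'a \<Rightarrow> 'a) \<Rightarrow> bool" where
  "rack X op \<longleftrightarrow>
     (\<forall>x\<in>X. \<forall>y\<in>X. op x y \<in> X) \<and>
     (\<forall>y\<in>X. bij_betw (\<lambda>x. op x y) X X) \<and>
     (\<forall>x\<in>X. \<forall>y\<in>X. \<forall>z\<in>X. op (op z x) y = op (op z y) (op x y))"

definition prod_op :: "('a \<Rightarrow> 'a \<Rightarrow> 'a) \<Rightarrow> ('b \<Rightarrow> 'b \<Rightarrow> 'b) \<Rightarrow> ('a \<times> 'b) \<Rightarrow> ('a \<times> 'b) \<Rightarrow> ('a \<times> 'b)" where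
  "prod_op opX opY p q = (opX (fst p) (fst q), opY (snd p) (snd q))"

definition comp_rel :: "'a set \<Rightarrow> ('a \<Rightarrow> 'a \<Rightarrow> 'a) \<Rightarrow> ('a \<times> 'a) set" where
  "comp_rel X op =
     (let R = {(x, op x y) | x y. x \<in> X \<and> y \<in> X} in (R \<union> R\<inverse>)\<^sup>* \<inter> (X \<times> X))"

definition triv :: "'a set \<Rightarrow> ('a \<Rightarrow> 'a \<Rightarrow> 'a) \<Rightarrow> 'a set set" where
  "triv X op = X // comp_rel X op"

definition triv_map :: "'a set \<Rightarrow> ('a \<Rightarrow> 'a \<Rightarrow> 'a) \<Rightarrow> 'b set \<Rightarrow> ('b \<Rightarrow> 'b \<Rightarrow> 'b)
    \<Rightarrow> ('a \<times> 'b) set \<Rightarrow> 'a set \<times> 'b set" where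
  "triv_map X opX Y opY C =
     (comp_rel X opX `` {fst (SOME p. p \<in> C)}, comp_rel Y opY `` {snd (SOME p. p \<in> C)})"

definition synchronized :: "'a set \<Rightarrow> ('a \<Rightarrow> 'a \<Rightarrow> 'a) \<Rightarrow> 'b set \<Rightarrow> ('b \<Rightarrow> 'b \<Rightarrow> 'b) \<Rightarrow> bool" where
  "synchronized X opX Y opY \<longleftrightarrow>
     bij_betw (triv_map X opX Y opY) (triv (X \<times> Y) (prod_op opX opY)) (triv X opX \<times> triv Y opY)"

text \<open>Words are lists of letters (x, True) = x and (x, False) = x^-1.\<close>
definition words :: "'a set \<Rightarrow> ('a \<times> bool) list set" where
  "words X = lists (X \<times> UNIV)"

definition gamma_base :: "'a set \<Rightarrow> ('a \<Rightarrow> 'a \<Rightarrow> 'a) \<Rightarrow> (('a \<times> bool) list \<times> ('a \<times> bool) list) set" where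
  "gamma_base X op =
     {([(x, True), (x, False)], []) | x. x \<in> X} \<union>
     {([(x, False), (x, True)], []) | x. x \<in> X} \<union>
     {([(y, False), (x, True), (y, True)], [(op x y, True)]) | x y. x \<in> X \<and> y \<in> X}"

definition gamma_rel :: "'a set \<Rightarrow> ('a \<Rightarrow> 'a \<Rightarrow> 'a) \<Rightarrow> (('a \<times> bool) list \<times> ('a \<times> bool) list) set" where
  "gamma_rel X op =
     (let R = {(u @ a @ v, u @ b @ v) | u a b v.
                 (a, b) \<in> gamma_base X op \<and> u \<in> words X \<and> v \<in> words X}
      in (R \<union> R\<inverse>)\<^sup>* \<inter> (words X \<times> words X))"

definition Gamma :: "'a set \<Rightarrow> ('a \<Rightarrow> 'a \<Rightarrow> 'a) \<Rightarrow> ('a \<times> bool) list set monoid" where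
  "Gamma X op =
     \<lparr> carrier = words X // gamma_rel X op,
       mult = (\<lambda>A B. gamma_rel X op `` {(SOME a. a \<in> A) @ (SOME b. b \<in> B)}),
       one = gamma_rel X op `` {[]} \<rparr>"

definition gamma_map :: "'b set \<Rightarrow> ('b \<Rightarrow> 'b \<Rightarrow> 'b) \<Rightarrow> ('a \<Rightarrow> 'b)
    \<Rightarrow> ('a \<times> bool) list set \<Rightarrow> ('b \<times> bool) list set" where
  "gamma_map Y opY h A = gamma_rel Y opY `` {map (\<lambda>l. (h (fst l), snd l)) (SOME a. a \<in> A)}"

definition productive :: "'a set \<Rightarrow> ('a \<Rightarrow> 'a \<Rightarrow> 'a) \<Rightarrow> 'b set \<Rightarrow> ('b \<Rightarrow> 'b \<Rightarrow> 'b) \<Rightarrow> bool" where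
  "productive X opX Y opY \<longleftrightarrow>
     (let G = Gamma (X \<times> Y) (prod_op opX opY) in
      inj_on (\<lambda>A. (gamma_map X opX fst A, gamma_map Y opY snd A)) (derived G (carrier G)))"

text \<open>Generator sigma_i (0-based i) acting on tuples (lists).\<close>
definition braid_step :: "('a \<Rightarrow> 'a \<Rightarrow> 'a) \<Rightarrow> nat \<Rightarrow> 'a list \<Rightarrow> 'a list" where
  "braid_step op i zs = zs[i := zs ! Suc i, Suc i := op (zs ! i) (zs ! Suc i)]"

text \<open>Orbit relation of the B_n action: equivalence closure of the generator moves.\<close>
definition braid_rel :: "'a set \<Rightarrow> ('a \<Rightarrow> 'a \<Rightarrow> 'a) \<Rightarrow> ('a list \<times> 'a list) set" where
  "braid_rel Z op =
     (let R = {(zs, braid_step op i zs) | zs i. zs \<in> lists Z \<and> Suc i < length zs}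
      in (R \<union> R\<inverse>)\<^sup>* \<inter> (lists Z \<times> lists Z))"

definition S :: "'a set \<Rightarrow> ('a \<Rightarrow> 'a \<Rightarrow> 'a) \<Rightarrow> 'a list set set" where
  "S Z op = (lists Z - {[]}) // braid_rel Z op"

definition S_proj :: "'b set \<Rightarrow> ('b \<Rightarrow> 'b \<Rightarrow> 'b) \<Rightarrow> ('a \<Rightarrow> 'b) \<Rightarrow> 'a list set \<Rightarrow> 'b list set" where
  "S_proj W opW f v = braid_rel W opW `` {map f (SOME xs. xs \<in> v)}"

definition generates :: "'a set \<Rightarrow> ('a \<Rightarrow> 'a \<Rightarrow> 'a) \<Rightarrow> 'a list \<Rightarrow> bool" where
  "generates Z op zs \<longleftrightarrow>
     (\<forall>T. set zs \<subseteq> T \<and> T \<subseteq> Z \<and> (\<forall>x\<in>T. \<forall>y\<in>T. op x y \<in> T) \<longrightarrow> T = Z)"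

definition S_star :: "'a set \<Rightarrow> ('a \<Rightarrow> 'a \<Rightarrow> 'a) \<Rightarrow> nat \<Rightarrow> 'a list set set" where
  "S_star Z op N =
     {braid_rel Z op `` {zs} | zs. zs \<in> lists Z \<and> zs \<noteq> [] \<and> generates Z op zs \<and>
        (\<forall>C \<in> triv Z op. N \<le> length (filter (\<lambda>z. z \<in> C) zs))}"

definition count_proj :: "'a set \<Rightarrow> ('a \<Rightarrow> 'a \<Rightarrow> 'a) \<Rightarrow> 'b set \<Rightarrow> ('b \<Rightarrow> 'b \<Rightarrow> 'b)
    \<Rightarrow> ('a \<times> 'b) list set \<Rightarrow> 'a set \<times> 'b set \<Rightarrow> nat" where
  "count_proj X opX Y opY v t =
     length (filter (\<lambda>z. (comp_rel X opX `` {fst z}, comp_rel Y opY `` {snd z}) = t)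
                    (SOME xs. xs \<in> v))"

end

theory Submission
  imports Defs
begin

text \<open>
  Write \<open>M\<close> for the monoid of braid orbits of tuples in a finite rack \<open>Z\<close>: it is presented by
  \<open>x y = y x^y\<close>, and \<open>\<Gamma>_Z\<close> is its group completion. For a suitable period \<open>m\<close> every power
  \<open>y^m\<close> is central in \<open>M\<close>, and on orbits of generating tuples it acts in a way that depends only
  on the component of \<open>y\<close>. By pigeonhole, such a central element can be split off from every
  generating tuple with many entries in that component, so multiplication by it is surjective
  between finite sets of orbits with prescribed component counts. The cardinalities of these sets
  are therefore eventually constant along each residue class of counts modulo \<open>m\<close>, and there the
  multiplication is injective. Hence large generating tuples with equal counts are equal in \<open>M\<close>
  as soon as their products in \<open>\<Gamma>_Z\<close> agree.

  For \<open>Z = X \<times> Y\<close>, synchronization turns condition (iii) into equality of all component counts,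
  so the quotient of the two products lies in the commutator subgroup; by (i) and (ii) it maps to
  the identity in \<open>\<Gamma>_X\<close> and \<open>\<Gamma>_Y\<close>, and productivity shows that it is trivial.
\<close>

section \<open>Equivalence closures\<close>

lemma equiv_closure: "equiv A ((R \<union> R\<inverse>)\<^sup>* \<inter> A \<times> A)"
proof (rule equivI)
  have "sym ((R \<union> R\<inverse>)\<^sup>*)" by (intro sym_rtrancl) (auto simp: sym_def)
  then show "sym ((R \<union> R\<inverse>)\<^sup>* \<inter> A \<times> A)" by (auto simp: sym_def)
  show "trans ((R \<union> R\<inverse>)\<^sup>* \<inter> A \<times> A)" by (auto simp: trans_def)
qed (auto simp: refl_on_def)

text \<open>Components, braid orbits and \<open>Gamma\<close> are all given by equivalence closures,
  so compatibility proofs only need an equivalence relation that contains the generating moves;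
  \<open>equiv_pullback\<close> and \<open>equiv_kernel\<close> provide such relations.\<close>

lemma closure_least:
  assumes "R \<subseteq> Q" "equiv A Q"
  shows "(R \<union> R\<inverse>)\<^sup>* \<inter> A \<times> A \<subseteq> Q"
proof clarify
  fix x y assume "(x, y) \<in> (R \<union> R\<inverse>)\<^sup>*" "x \<in> A"
  then show "(x, y) \<in> Q"
  proof (induction rule: rtrancl_induct)
    case base
    then show ?case using assms(2) by (meson equivE refl_onD)
  next
    case (step y z)
    then have "(y, z) \<in> Q" using assms by (auto elim!: equivE dest: symD)
    then show ?case using step assms(2) by (meson equivE transD)
  qed
qed

lemma closure_base: "R \<subseteq> A \<times> A \<Longrightarrow> (x, y) \<in> R \<Longrightarrow> (x, y) \<in> (R \<union> R\<inverse>)\<^sup>* \<inter> A \<times> A"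
  by auto

lemma equiv_pullback:
  assumes "equiv B Q" "f ` A \<subseteq> B"
  shows "equiv A {(x, y). x \<in> A \<and> y \<in> A \<and> (f x, f y) \<in> Q}"
proof (rule equivI)
  show "refl_on A {(x, y). x \<in> A \<and> y \<in> A \<and> (f x, f y) \<in> Q}"
    using assms by (auto simp: refl_on_def elim!: equivE)
  show "sym {(x, y). x \<in> A \<and> y \<in> A \<and> (f x, f y) \<in> Q}"
    using assms(1) unfolding equiv_def sym_def by blast
  show "trans {(x, y). x \<in> A \<and> y \<in> A \<and> (f x, f y) \<in> Q}"
    using assms(1) unfolding equiv_def trans_def by blast
qed auto

lemma equiv_kernel: "equiv A {(x, y). x \<in> A \<and> y \<in> A \<and> f x = f y}"
  by (intro equivI) (auto simp: refl_on_def sym_def trans_def)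

locale rack_structure =
  fixes Z :: "'a set" and op :: "'a \<Rightarrow> 'a \<Rightarrow> 'a"
  assumes is_rack: "rack Z op"
begin

lemma op_closed [simp]: "x \<in> Z \<Longrightarrow> y \<in> Z \<Longrightarrow> op x y \<in> Z"
  using is_rack unfolding rack_def by blast

lemma op_bij: "y \<in> Z \<Longrightarrow> bij_betw (\<lambda>x. op x y) Z Z"
  using is_rack unfolding rack_def by blast

lemma op_distrib:
  "x \<in> Z \<Longrightarrow> y \<in> Z \<Longrightarrow> z \<in> Z \<Longrightarrow> op (op z x) y = op (op z y) (op x y)"
  using is_rack unfolding rack_def by blast

lemma op_surj:
  assumes "z \<in> Z" "y \<in> Z" obtains x where "x \<in> Z" "op x y = z"
  using op_bij[OF \<open>y \<in> Z\<close>] \<open>z \<in> Z\<close> by (metis bij_betw_imp_surj_on imageE)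

section \<open>Components\<close>

lemma comp_equiv: "equiv Z (comp_rel Z op)"
  unfolding comp_rel_def Let_def by (rule equiv_closure)

lemma comp_least:
  assumes "equiv Z Q" "\<And>x y. x \<in> Z \<Longrightarrow> y \<in> Z \<Longrightarrow> (x, op x y) \<in> Q"
  shows "comp_rel Z op \<subseteq> Q"
  unfolding comp_rel_def Let_def by (rule closure_least) (use assms in auto)

lemma comp_op: "x \<in> Z \<Longrightarrow> y \<in> Z \<Longrightarrow> (x, op x y) \<in> comp_rel Z op"
  unfolding comp_rel_def Let_def by (rule closure_base) auto

lemma comp_in_Z: "(x, y) \<in> comp_rel Z op \<Longrightarrow> x \<in> Z \<and> y \<in> Z"
  by (auto simp: comp_rel_def Let_def)

lemma triv_subset: "C \<in> triv Z op \<Longrightarrow> C \<subseteq> Z"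
  unfolding triv_def using comp_in_Z by (auto elim!: quotientE)

lemma comp_class_in_triv: "x \<in> Z \<Longrightarrow> comp_rel Z op `` {x} \<in> triv Z op"
  unfolding triv_def by (rule quotientI)

lemma comp_class_self: "x \<in> Z \<Longrightarrow> x \<in> comp_rel Z op `` {x}"
  by (rule equiv_class_self[OF comp_equiv])

lemma mem_triv_iff:
  assumes "C \<in> triv Z op" "(x, y) \<in> comp_rel Z op"
  shows "x \<in> C \<longleftrightarrow> y \<in> C"
proof -
  obtain z where C: "C = comp_rel Z op `` {z}"
    using assms(1) unfolding triv_def by (rule quotientE)
  have "(z, x) \<in> comp_rel Z op \<longleftrightarrow> (z, y) \<in> comp_rel Z op"
    using comp_equiv assms(2) by (meson equivE symD transD)
  then show ?thesis by (simp add: C)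
qed

lemma triv_class_eq:
  assumes "C \<in> triv Z op" "x \<in> C"
  shows "C = comp_rel Z op `` {x}"
proof -
  obtain z where C: "C = comp_rel Z op `` {z}"
    using assms(1) unfolding triv_def by (rule quotientE)
  then have "(z, x) \<in> comp_rel Z op" using assms(2) by simp
  then show ?thesis unfolding C by (rule equiv_class_eq[OF comp_equiv])
qed

definition comp_count :: "'a set \<Rightarrow> 'a list \<Rightarrow> nat" where
  "comp_count C zs = length (filter (\<lambda>z. z \<in> C) zs)"

lemma comp_count_simps [simp]:
  "comp_count C [] = 0"
  "comp_count C (x # zs) = (if x \<in> C then 1 else 0) + comp_count C zs"
  "comp_count C (zs @ zs') = comp_count C zs + comp_count C zs'"
  "comp_count C (replicate n x) = (if x \<in> C then n else 0)"
  by (auto simp: comp_count_def filter_replicate)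

lemma comp_count_le_length: "comp_count C zs \<le> length zs"
  by (simp add: comp_count_def)

text \<open>The head \<open>y\<close> has a partner \<open>y'\<close> in its component somewhere in
  the other tuple, and deleting both keeps the counts equal. This compares quantities that depend
  only on components and not on order.\<close>

lemma same_counts_induct [consumes 3, case_names Nil Cons]:
  assumes "ys \<in> lists Z" "ys' \<in> lists Z" "\<forall>C\<in>triv Z op. comp_count C ys = comp_count C ys'"
    and "P [] []"
    and "\<And>y ys y' a b. \<lbrakk>(y, y') \<in> comp_rel Z op; ys \<in> lists Z; a \<in> lists Z; b \<in> lists Z;
           \<forall>C\<in>triv Z op. comp_count C ys = comp_count C (a @ b); P ys (a @ b)\<rbrakk>
         \<Longrightarrow> P (y # ys) (a @ y' # b)"
  shows "P ys ys'"
  using assms(1-3)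
proof (induction ys arbitrary: ys' rule: list.induct)
  case Nil
  have "ys' = []"
  proof (cases ys')
    case (Cons y zs)
    then have "comp_count (comp_rel Z op `` {y}) ys' \<noteq> 0"
      using Nil comp_class_self by simp
    then show ?thesis using Nil(3)[THEN bspec, of "comp_rel Z op `` {y}"] Nil(2) Cons comp_class_in_triv by simp
  qed simp
  then show ?case using assms(4) by simp
next
  case (Cons y ys)
  let ?C = "comp_rel Z op `` {y}"
  have y: "y \<in> Z" using Cons by simp
  have "comp_count ?C ys' \<noteq> 0"
    using Cons.prems(3)[THEN bspec, OF comp_class_in_triv[OF y]] comp_class_self[OF y] by simp
  then obtain y' where "y' \<in> set ys'" "y' \<in> ?C"
    by (auto simp: comp_count_def filter_empty_conv)
  then obtain a b where ys': "ys' = a @ y' # b" and yy': "(y, y') \<in> comp_rel Z op"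
    by (auto dest: split_list)

  have ls: "ys \<in> lists Z" "a \<in> lists Z" "b \<in> lists Z" using Cons.prems ys' by auto
  have c: "\<forall>C\<in>triv Z op. comp_count C ys = comp_count C (a @ b)"
    using Cons.prems(3) mem_triv_iff[OF _ yy'] by (auto simp: ys' split: if_splits)
  have "P ys (a @ b)" using Cons.IH[of "a @ b"] ls c by simp
  then show ?case unfolding ys' using assms(5)[OF yy' ls c] by blast
qed

section \<open>Braid orbits\<close>

definition braid_eq (infix "\<approx>" 50) where
  "u \<approx> v \<longleftrightarrow> (u, v) \<in> braid_rel Z op"

text \<open>Trades indexed generators for a local rewriting of adjacent entries, so that orbits
  become classes of words under \<open>x y = y (op x y)\<close>.\<close>

lemma braid_moves:
  "{(zs, braid_step op i zs) | zs i. zs \<in> lists Z \<and> Suc i < length zs} =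
   {(a @ [x, y] @ b, a @ [y, op x y] @ b) | a b x y. a \<in> lists Z \<and> b \<in> lists Z \<and> x \<in> Z \<and> y \<in> Z}"
  (is "?L = ?R")
proof (rule equalityI)
  show "?L \<subseteq> ?R"
  proof
    fix p assume "p \<in> ?L"
    then obtain zs i where p: "p = (zs, braid_step op i zs)"
      and zs: "zs \<in> lists Z" "Suc i < length zs" by blast
    define a b x y where "a = take i zs" "b = drop (Suc (Suc i)) zs" "x = zs ! i" "y = zs ! Suc i"
    then have eq: "zs = a @ [x, y] @ b" and l: "length a = i"
      using zs by (simp_all add: Cons_nth_drop_Suc)
    have "braid_step op i zs = a @ [y, op x y] @ b"
      unfolding braid_step_def eq l[symmetric] by (simp add: list_update_append nth_append)
    then show "p \<in> ?R"
      unfolding p using eq zs(1) by auto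
  qed
  show "?R \<subseteq> ?L"
  proof
    fix p assume "p \<in> ?R"
    then obtain a b x y where p: "p = (a @ [x, y] @ b, a @ [y, op x y] @ b)"
      and z: "a \<in> lists Z" "b \<in> lists Z" "x \<in> Z" "y \<in> Z" by blast
    have "braid_step op (length a) (a @ [x, y] @ b) = a @ [y, op x y] @ b"
      by (simp add: braid_step_def list_update_append nth_append)
    then have "p = (a @ [x, y] @ b, braid_step op (length a) (a @ [x, y] @ b))"
      by (simp add: p)
    moreover have "a @ [x, y] @ b \<in> lists Z" "Suc (length a) < length (a @ [x, y] @ b)"
      using z by auto
    ultimately show "p \<in> ?L" by blast
  qed
qed

lemma braid_equiv: "equiv (lists Z) (braid_rel Z op)"
  unfolding braid_rel_def Let_def by (rule equiv_closure)

lemma braid_least: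
  assumes "equiv (lists Z) Q"
    and "\<And>a b x y. \<lbrakk>a \<in> lists Z; b \<in> lists Z; x \<in> Z; y \<in> Z\<rbrakk>
           \<Longrightarrow> (a @ [x, y] @ b, a @ [y, op x y] @ b) \<in> Q"
  shows "braid_rel Z op \<subseteq> Q"
  unfolding braid_rel_def Let_def braid_moves by (rule closure_least) (use assms in auto)

lemma braid_swap:
  "\<lbrakk>a \<in> lists Z; b \<in> lists Z; x \<in> Z; y \<in> Z\<rbrakk> \<Longrightarrow> a @ [x, y] @ b \<approx> a @ [y, op x y] @ b"
  unfolding braid_eq_def braid_rel_def Let_def braid_moves by (rule closure_base) auto

lemma braid_refl [simp]: "u \<in> lists Z \<Longrightarrow> u \<approx> u"
  using braid_equiv unfolding braid_eq_def by (meson equivE refl_onD)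

lemma braid_sym: "u \<approx> v \<Longrightarrow> v \<approx> u"
  using braid_equiv unfolding braid_eq_def by (meson equivE symD)

lemma braid_trans [trans]: "u \<approx> v \<Longrightarrow> v \<approx> w \<Longrightarrow> u \<approx> w"
  using braid_equiv unfolding braid_eq_def by (meson equivE transD)

lemma braid_lists: "u \<approx> v \<Longrightarrow> u \<in> lists Z \<and> v \<in> lists Z"
  by (auto simp: braid_eq_def braid_rel_def Let_def)

lemma braid_class_eq_iff:
  "u \<in> lists Z \<Longrightarrow> v \<in> lists Z \<Longrightarrow> braid_rel Z op `` {u} = braid_rel Z op `` {v} \<longleftrightarrow> u \<approx> v"
  unfolding braid_eq_def by (rule eq_equiv_class_iff[OF braid_equiv])

text \<open>A move does not see the surrounding entries; this is what makes concatenation of orbits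
  well defined.\<close>

lemma braid_context:
  assumes "u \<approx> v" "c \<in> lists Z" "d \<in> lists Z"
  shows "c @ u @ d \<approx> c @ v @ d"
proof -
  let ?Q = "{(u, v). u \<in> lists Z \<and> v \<in> lists Z \<and> c @ u @ d \<approx> c @ v @ d}"
  have "braid_rel Z op \<subseteq> ?Q"
  proof (rule braid_least)
    show "equiv (lists Z) ?Q"
      unfolding braid_eq_def by (rule equiv_pullback[OF braid_equiv]) (use assms in auto)
    fix a b x y assume "a \<in> lists Z" "b \<in> lists Z" "x \<in> Z" "y \<in> Z"
    then show "(a @ [x, y] @ b, a @ [y, op x y] @ b) \<in> ?Q"
      using braid_swap[of "c @ a" "b @ d" x y] assms by simp
  qed
  then show ?thesis using assms(1) by (auto simp: braid_eq_def)
qed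

lemma braid_append:
  assumes "u \<approx> u'" "v \<approx> v'"
  shows "u @ v \<approx> u' @ v'"
proof -
  have "u @ v \<approx> u' @ v"
    using braid_context[OF assms(1), of "[]" v] braid_lists[OF assms(2)] by simp
  also have "u' @ v \<approx> u' @ v'"
    using braid_context[OF assms(2), of u' "[]"] braid_lists[OF assms(1)] by simp
  finally show ?thesis .
qed

lemma braid_append_left: "u \<in> lists Z \<Longrightarrow> v \<approx> v' \<Longrightarrow> u @ v \<approx> u @ v'"
  by (rule braid_append[OF braid_refl])

lemma braid_append_right: "v \<in> lists Z \<Longrightarrow> u \<approx> u' \<Longrightarrow> u @ v \<approx> u' @ v"
  by (rule braid_append[OF _ braid_refl])

lemma braid_comp_count:
  assumes "u \<approx> v" "C \<in> triv Z op"
  shows "comp_count C u = comp_count C v"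
proof -
  have "braid_rel Z op \<subseteq> {(u, v). u \<in> lists Z \<and> v \<in> lists Z \<and> comp_count C u = comp_count C v}"
    by (rule braid_least[OF equiv_kernel])
       (simp add: mem_triv_iff[OF assms(2) comp_op, symmetric])
  then show ?thesis using assms(1) by (auto simp: braid_eq_def)
qed

section \<open>The structure group\<close>

definition gamma_eq (infix "\<simeq>" 50) where
  "u \<simeq> v \<longleftrightarrow> (u, v) \<in> gamma_rel Z op"

lemma words_simps [simp]:
  "[] \<in> words Z"
  "l # u \<in> words Z \<longleftrightarrow> fst l \<in> Z \<and> u \<in> words Z"
  "u @ v \<in> words Z \<longleftrightarrow> u \<in> words Z \<and> v \<in> words Z"
  by (cases l; auto simp: words_def)+

lemma gamma_base_words: "(a, b) \<in> gamma_base Z op \<Longrightarrow> a \<in> words Z \<and> b \<in> words Z"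
  by (auto simp: gamma_base_def)

lemma gamma_equiv: "equiv (words Z) (gamma_rel Z op)"
  unfolding gamma_rel_def Let_def by (rule equiv_closure)

lemma gamma_least:
  assumes "equiv (words Z) Q"
    and "\<And>u a b v. \<lbrakk>(a, b) \<in> gamma_base Z op; u \<in> words Z; v \<in> words Z\<rbrakk>
           \<Longrightarrow> (u @ a @ v, u @ b @ v) \<in> Q"
  shows "gamma_rel Z op \<subseteq> Q"
  unfolding gamma_rel_def Let_def by (rule closure_least) (use assms in auto)

lemma gamma_step:
  "\<lbrakk>(a, b) \<in> gamma_base Z op; u \<in> words Z; v \<in> words Z\<rbrakk> \<Longrightarrow> u @ a @ v \<simeq> u @ b @ v"
  unfolding gamma_eq_def gamma_rel_def Let_def
  by (rule closure_base) (auto dest: gamma_base_words)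

lemma gamma_refl [simp]: "u \<in> words Z \<Longrightarrow> u \<simeq> u"
  using gamma_equiv unfolding gamma_eq_def by (meson equivE refl_onD)

lemma gamma_sym: "u \<simeq> v \<Longrightarrow> v \<simeq> u"
  using gamma_equiv unfolding gamma_eq_def by (meson equivE symD)

lemma gamma_trans [trans]: "u \<simeq> v \<Longrightarrow> v \<simeq> w \<Longrightarrow> u \<simeq> w"
  using gamma_equiv unfolding gamma_eq_def by (meson equivE transD)

lemma gamma_words: "u \<simeq> v \<Longrightarrow> u \<in> words Z \<and> v \<in> words Z"
  by (auto simp: gamma_eq_def gamma_rel_def Let_def)

lemma gamma_context:
  assumes "u \<simeq> v" "c \<in> words Z" "d \<in> words Z"
  shows "c @ u @ d \<simeq> c @ v @ d"
proof -
  let ?Q = "{(u, v). u \<in> words Z \<and> v \<in> words Z \<and> c @ u @ d \<simeq> c @ v @ d}"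
  have "gamma_rel Z op \<subseteq> ?Q"
  proof (rule gamma_least)
    show "equiv (words Z) ?Q"
      unfolding gamma_eq_def by (rule equiv_pullback[OF gamma_equiv]) (use assms in auto)
    fix u a b v assume "(a, b) \<in> gamma_base Z op" "u \<in> words Z" "v \<in> words Z"
    then show "(u @ a @ v, u @ b @ v) \<in> ?Q"
      using gamma_step[of a b "c @ u" "v @ d"] gamma_base_words[of a b] assms by simp
  qed
  then show ?thesis using assms(1) by (auto simp: gamma_eq_def)
qed

lemma gamma_append:
  assumes "u \<simeq> u'" "v \<simeq> v'"
  shows "u @ v \<simeq> u' @ v'"
proof -
  have "u @ v \<simeq> u' @ v"
    using gamma_context[OF assms(1), of "[]" v] gamma_words[OF assms(2)] by simp
  also have "u' @ v \<simeq> u' @ v'"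
    using gamma_context[OF assms(2), of u' "[]"] gamma_words[OF assms(1)] by simp
  finally show ?thesis .
qed

definition inv_word :: "('a \<times> bool) list \<Rightarrow> ('a \<times> bool) list" where
  "inv_word u = rev (map (\<lambda>l. (fst l, \<not> snd l)) u)"

lemma inv_word_words [simp]: "inv_word u \<in> words Z \<longleftrightarrow> u \<in> words Z"
  by (induction u) (auto simp: inv_word_def)

lemma inv_word_inv_word [simp]: "inv_word (inv_word u) = u"
  by (induction u) (auto simp: inv_word_def)

lemma append_inv_word: "u \<in> words Z \<Longrightarrow> u @ inv_word u \<simeq> []"
proof (induction u)
  case (Cons l u)
  obtain x b where l: "l = (x, b)" by (cases l)
  then have x: "x \<in> Z" "u \<in> words Z" using Cons.prems by auto
  have "[l] @ (u @ inv_word u) @ [(x, \<not> b)] \<simeq> [l] @ [] @ [(x, \<not> b)]"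
    using Cons x l by (intro gamma_context) auto
  also have "[] @ [l, (x, \<not> b)] @ [] \<simeq> [] @ [] @ []"
    using x l by (intro gamma_step) (cases b, auto simp: gamma_base_def)
  then have "[l] @ [] @ [(x, \<not> b)] \<simeq> []" by simp
  finally show ?case by (simp add: inv_word_def l)
qed (simp add: inv_word_def)

lemma inv_word_append: "u \<in> words Z \<Longrightarrow> inv_word u @ u \<simeq> []"
  using append_inv_word[of "inv_word u"] by simp

abbreviation gamma_class :: "('a \<times> bool) list \<Rightarrow> ('a \<times> bool) list set" where
  "gamma_class u \<equiv> gamma_rel Z op `` {u}"

lemma gamma_class_eq_iff:
  "u \<in> words Z \<Longrightarrow> v \<in> words Z \<Longrightarrow> gamma_class u = gamma_class v \<longleftrightarrow> u \<simeq> v"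
  unfolding gamma_eq_def by (rule eq_equiv_class_iff[OF gamma_equiv])

lemma gamma_class_some: "u \<in> words Z \<Longrightarrow> u \<simeq> (SOME v. v \<in> gamma_class u)"
  using someI[of "\<lambda>v. v \<in> gamma_class u", OF equiv_class_self[OF gamma_equiv]]
  by (simp add: gamma_eq_def)

lemma Gamma_carrier: "carrier (Gamma Z op) = gamma_class ` words Z"
  by (auto simp: Gamma_def quotient_def)

text \<open>The product in \<open>Gamma\<close> is taken on representatives chosen by
  \<open>SOME\<close>; \<open>gamma_append\<close> makes the choice irrelevant.\<close>

lemma Gamma_mult:
  assumes "u \<in> words Z" "v \<in> words Z"
  shows "gamma_class u \<otimes>\<^bsub>Gamma Z op\<^esub> gamma_class v = gamma_class (u @ v)"
proof -
  have "u @ v \<simeq> (SOME a. a \<in> gamma_class u) @ (SOME b. b \<in> gamma_class v)"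
    using assms by (intro gamma_append gamma_class_some)
  then have "gamma_class (u @ v) = gamma_class ((SOME a. a \<in> gamma_class u) @ (SOME b. b \<in> gamma_class v))"
    unfolding gamma_eq_def by (rule equiv_class_eq[OF gamma_equiv])
  then show ?thesis by (simp add: Gamma_def)
qed

lemma Gamma_one: "\<one>\<^bsub>Gamma Z op\<^esub> = gamma_class []"
  by (simp add: Gamma_def)

lemma Gamma_group: "group (Gamma Z op)"
proof (rule groupI)
  fix x assume "x \<in> carrier (Gamma Z op)"
  then obtain u where u: "u \<in> words Z" "x = gamma_class u" by (auto simp: Gamma_carrier)
  show "\<exists>y\<in>carrier (Gamma Z op). y \<otimes>\<^bsub>Gamma Z op\<^esub> x = \<one>\<^bsub>Gamma Z op\<^esub>"
    using u inv_word_append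
    by (intro bexI[of _ "gamma_class (inv_word u)"])
       (auto simp: Gamma_carrier Gamma_mult Gamma_one gamma_class_eq_iff)
qed (auto simp: Gamma_carrier Gamma_mult Gamma_one)

lemma Gamma_inv: "u \<in> words Z \<Longrightarrow> inv\<^bsub>Gamma Z op\<^esub> (gamma_class u) = gamma_class (inv_word u)"
  by (rule group.inv_equality[OF Gamma_group])
     (auto simp: Gamma_carrier Gamma_mult Gamma_one gamma_class_eq_iff inv_word_append)

definition pos_word :: "'a list \<Rightarrow> ('a \<times> bool) list" where
  "pos_word zs = map (\<lambda>x. (x, True)) zs"

lemma pos_word_simps [simp]:
  "pos_word [] = []"
  "pos_word (x # u) = (x, True) # pos_word u"
  "pos_word (u @ v) = pos_word u @ pos_word v"
  by (auto simp: pos_word_def)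

lemma pos_word_words [simp]: "pos_word u \<in> words Z \<longleftrightarrow> u \<in> lists Z"
  by (induction u) auto

lemma gamma_conj:
  assumes "x \<in> Z" "y \<in> Z"
  shows "[(y, False), (x, True), (y, True)] \<simeq> [(op x y, True)]"
  using gamma_step[of "[(y, False), (x, True), (y, True)]" "[(op x y, True)]" "[]" "[]"] assms
  by (auto simp: gamma_base_def)

text \<open>Multiplying \<open>y^-1 x y = op x y\<close> by \<open>y\<close> on the left gives the
  braid move, so an orbit has a well-defined product in the group.\<close>

lemma braid_imp_gamma:
  assumes "u \<approx> v"
  shows "pos_word u \<simeq> pos_word v"
proof -
  let ?Q = "{(u, v). u \<in> lists Z \<and> v \<in> lists Z \<and> pos_word u \<simeq> pos_word v}"
  have "braid_rel Z op \<subseteq> ?Q"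
  proof (rule braid_least)
    show "equiv (lists Z) ?Q"
      unfolding gamma_eq_def by (rule equiv_pullback[OF gamma_equiv]) auto
    fix a b x y assume z: "a \<in> lists Z" "b \<in> lists Z" "x \<in> Z" "y \<in> Z"
    have "[(y, True)] @ [(op x y, True)] \<simeq> [(y, True)] @ [(y, False), (x, True), (y, True)]"
      using z by (intro gamma_append gamma_sym[OF gamma_conj]) auto
    also have "\<dots> \<simeq> [(x, True), (y, True)]"
      using gamma_append[OF append_inv_word[of "[(y, True)]"] gamma_refl[of "[(x, True), (y, True)]"]] z
      by (simp add: inv_word_def)
    finally have "[(x, True), (y, True)] \<simeq> [(y, True), (op x y, True)]"
      using gamma_sym by simp
    then have "pos_word a @ [(x, True), (y, True)] @ pos_word b
        \<simeq> pos_word a @ [(y, True), (op x y, True)] @ pos_word b"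
      using z by (intro gamma_context) auto
    then show "(a @ [x, y] @ b, a @ [y, op x y] @ b) \<in> ?Q" using z by simp
  qed
  then show ?thesis using assms by (auto simp: braid_eq_def)
qed

text \<open>In the abelianization \<open>x\<close> and its conjugate \<open>op x y\<close> coincide,
  so the image of a tuple depends only on its component counts.\<close>

lemma same_counts_derived:
  assumes uv: "u \<in> lists Z" "v \<in> lists Z" "\<forall>C\<in>triv Z op. comp_count C u = comp_count C v"
  shows "gamma_class (pos_word u @ inv_word (pos_word v)) \<in>
    derived (Gamma Z op) (carrier (Gamma Z op))"
proof -
  let ?G = "Gamma Z op"
  let ?D = "derived ?G (carrier ?G)"
  interpret G: group ?G by (rule Gamma_group)
  interpret D: normal ?D ?G by (rule G.derived_self_is_normal)
  interpret Q: comm_group "?G Mod ?D"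
    using G.derived_quot_of_subgroup_is_comm_group[OF G.subgroup_self] by simp
  define q where "q u = ?D #>\<^bsub>?G\<^esub> gamma_class u" for u
  have car: "gamma_class u \<in> carrier ?G" if "u \<in> words Z" for u
    using that by (simp add: Gamma_carrier)
  have q_closed: "q u \<in> carrier (?G Mod ?D)" if "u \<in> words Z" for u
    using car[OF that] unfolding q_def FactGroup_def by (auto simp: RCOSETS_def)
  have q_mult: "q (u @ v) = q u \<otimes>\<^bsub>?G Mod ?D\<^esub> q v" if "u \<in> words Z" "v \<in> words Z" for u v
    using that by (simp add: q_def D.rcos_sum car flip: Gamma_mult)
  have q_cong: "q u = q v" if "u \<simeq> v" for u v
    using that gamma_words[OF that] gamma_class_eq_iff[of u v] by (simp add: q_def)
  have q_op: "q [(x, True)] = q [(op x y, True)]" if z: "x \<in> Z" "y \<in> Z" for x y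
  proof -
    have "q [(op x y, True)] = q ([(y, False)] @ [(x, True)] @ [(y, True)])"
      using q_cong[OF gamma_conj[OF z]] by simp
    also have "\<dots> = q [(y, False)] \<otimes>\<^bsub>?G Mod ?D\<^esub> (q [(x, True)] \<otimes>\<^bsub>?G Mod ?D\<^esub> q [(y, True)])"
      using z by (simp add: q_mult del: append_Cons append_Nil)
    \<comment> \<open>Commutativity carries \<open>x\<close> past the inverse of \<open>y\<close>,
      which then cancels against \<open>y\<close>.\<close>
    also have "\<dots> = q [(x, True)] \<otimes>\<^bsub>?G Mod ?D\<^esub> (q [(y, False)] \<otimes>\<^bsub>?G Mod ?D\<^esub> q [(y, True)])"
      using z by (intro Q.m_lcomm q_closed) auto
    also have "\<dots> = q ([(x, True)] @ [(y, False)] @ [(y, True)])"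
      using z by (simp add: q_mult del: append_Cons append_Nil)
    also have "\<dots> = q ([(x, True)] @ [])"
      using inv_word_append[of "[(y, True)]"] z
      by (intro q_cong gamma_append) (auto simp: inv_word_def)
    finally show ?thesis by simp
  qed
  have q_comp: "q [(y, True)] = q [(y', True)]" if "(y, y') \<in> comp_rel Z op" for y y'
  proof -
    have "comp_rel Z op \<subseteq> {(y, y'). y \<in> Z \<and> y' \<in> Z \<and> q [(y, True)] = q [(y', True)]}"
      by (rule comp_least, rule equiv_kernel) (simp add: q_op[symmetric])
    then show ?thesis using that by auto
  qed
  have "q (pos_word u) = q (pos_word v)"
    using uv
  proof (induction rule: same_counts_induct)
    case (Cons y ys y' a b)
    have yy: "y \<in> Z" "y' \<in> Z" using comp_in_Z[OF Cons(1)] by auto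
    have "q (pos_word (y # ys)) = q ([(y, True)] @ pos_word ys)" by simp
    also have "\<dots> = q [(y, True)] \<otimes>\<^bsub>?G Mod ?D\<^esub> q (pos_word ys)"
      using yy Cons by (intro q_mult) auto
    also have "\<dots> = q [(y', True)] \<otimes>\<^bsub>?G Mod ?D\<^esub> (q (pos_word a) \<otimes>\<^bsub>?G Mod ?D\<^esub> q (pos_word b))"
      using Cons by (simp add: q_comp[OF Cons(1)] q_mult)
    also have "\<dots> = q (pos_word a) \<otimes>\<^bsub>?G Mod ?D\<^esub> (q [(y', True)] \<otimes>\<^bsub>?G Mod ?D\<^esub> q (pos_word b))"
      using yy Cons by (intro Q.m_lcomm q_closed) auto
    also have "\<dots> = q (pos_word a @ [(y', True)] @ pos_word b)"
      using yy Cons by (simp add: q_mult del: append_Cons append_Nil)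
    finally show ?case by simp
  qed simp
  \<comment> \<open>Both products lie in one coset of the derived subgroup, hence their quotient
    belongs to it.\<close>
  moreover have "gamma_class (pos_word u) \<in> q (pos_word u)"
    unfolding q_def using uv by (intro G.rcos_self car D.is_subgroup) simp
  ultimately have "gamma_class (pos_word u) \<otimes>\<^bsub>?G\<^esub> inv\<^bsub>?G\<^esub> (gamma_class (pos_word v)) \<in> ?D"
    using D.rcos_module[OF G.is_group, of "gamma_class (pos_word v)" "gamma_class (pos_word u)"]
      car uv by (simp add: q_def)
  then show ?thesis using uv by (simp add: Gamma_inv Gamma_mult)
qed

end

section \<open>Finite racks: subracks and a common period of the translations\<close>

locale finite_rack = rack_structure +
  assumes finite_Z: "finite Z"
begin

text \<open>The translation by \<open>y\<close> is injective and maps the finite set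
  \<open>T\<close> into itself, hence onto itself. So a set closed under the operation is also
  closed under undoing it.\<close>

lemma subrack_cancel:
  assumes "T \<subseteq> Z" "\<And>x y. x \<in> T \<Longrightarrow> y \<in> T \<Longrightarrow> op x y \<in> T"
    and "x \<in> Z" "y \<in> T" "op x y \<in> T"
  shows "x \<in> T"
proof -
  have inj: "inj_on (\<lambda>x. op x y) Z" using op_bij assms by (auto simp: bij_betw_def)
  have "(\<lambda>x. op x y) ` T = T"
    using assms(1,2,4) inj_on_subset[OF inj assms(1)] finite_subset[OF assms(1) finite_Z]
    by (intro endo_inj_surj) auto
  then obtain t where "t \<in> T" "op t y = op x y" using assms(5) by (metis imageE)
  then show ?thesis using inj assms(1,3) by (metis inj_onD subsetD)
qed

text \<open>Moves and, by \<open>subrack_cancel\<close>, their inverses stay inside every set closed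
  under the operation, so the tuples of one orbit lie in the same such sets.\<close>

lemma braid_generates:
  assumes "u \<approx> v"
  shows "generates Z op u \<longleftrightarrow> generates Z op v"
proof -
  have "set u \<subseteq> T \<longleftrightarrow> set v \<subseteq> T"
    if T: "T \<subseteq> Z" "\<And>x y. x \<in> T \<Longrightarrow> y \<in> T \<Longrightarrow> op x y \<in> T" for T
  proof -
    have "(x \<in> T \<and> y \<in> T) = (y \<in> T \<and> op x y \<in> T)" if "x \<in> Z" for x y
      using subrack_cancel[OF T that] T(2) by blast
    then have "braid_rel Z op \<subseteq> {(u, v). u \<in> lists Z \<and> v \<in> lists Z \<and> (set u \<subseteq> T) = (set v \<subseteq> T)}"
      by (intro braid_least[OF equiv_kernel]) (simp, blast)
    then show ?thesis using assms by (auto simp: braid_eq_def)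
  qed
  then show ?thesis unfolding generates_def by metis
qed

lemma generatesD:
  assumes "generates Z op u" "set u \<subseteq> T" "T \<subseteq> Z" "\<And>x y. x \<in> T \<Longrightarrow> y \<in> T \<Longrightarrow> op x y \<in> T"
  shows "T = Z"
proof -
  have "set u \<subseteq> T \<and> T \<subseteq> Z \<and> (\<forall>x\<in>T. \<forall>y\<in>T. op x y \<in> T) \<longrightarrow> T = Z"
    using assms(1) unfolding generates_def by (rule spec)
  then show ?thesis using assms(2-4) by simp
qed

lemma generates_mono: "set u \<subseteq> set v \<Longrightarrow> generates Z op u \<Longrightarrow> generates Z op v"
  unfolding generates_def by (meson subset_trans)

text \<open>Pigeonhole: two iterates agree, and bijectivity of the translations allows cancelling
  the smaller exponent.\<close>

lemma common_period:
  "\<exists>m>0. \<forall>x\<in>Z. \<forall>y\<in>Z. ((\<lambda>x. op x y) ^^ m) x = x"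
proof -
  \<comment> \<open>Tabulates the \<open>n\<close>-th iterates of all translations at once, so that
    one coincidence gives an exponent valid for every \<open>y\<close>; the restriction places the
    tables in a finite set.\<close>
  define act where "act n = (\<lambda>(x, y)\<in>Z \<times> Z. ((\<lambda>x. op x y) ^^ n) x)" for n
  have bij: "bij_betw ((\<lambda>x. op x y) ^^ n) Z Z" if "y \<in> Z" for y n
    by (rule bij_betw_funpow[OF op_bij[OF that]])
  have "range act \<subseteq> (Z \<times> Z) \<rightarrow>\<^sub>E Z"
    unfolding act_def using bij_betw_apply[OF bij] by (intro image_subsetI, subst restrict_PiE_iff) auto
  moreover have "finite ((Z \<times> Z) \<rightarrow>\<^sub>E Z)"
    by (intro finite_PiE) (auto simp: finite_Z)
  ultimately have "\<not> inj act"
    using finite_subset finite_imageD infinite_UNIV_nat by blast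
  then obtain i j where ij: "i < j" "act i = act j"
    by (metis injI linorder_neqE_nat)
  have "((\<lambda>x. op x y) ^^ (j - i)) x = x" if xy: "x \<in> Z" "y \<in> Z" for x y
  proof -
    have "x \<in> ((\<lambda>x. op x y) ^^ i) ` Z" using bij[OF xy(2)] xy(1) by (simp add: bij_betw_def)
    then obtain z where z: "z \<in> Z" "x = ((\<lambda>x. op x y) ^^ i) z" by blast
    have "((\<lambda>x. op x y) ^^ (j - i)) x = ((\<lambda>x. op x y) ^^ (j - i + i)) z"
      by (simp only: funpow_add z(2) comp_apply)
    also have "\<dots> = act j (z, y)" using ij z xy by (simp add: act_def)
    also have "\<dots> = act i (z, y)" using ij by simp
    also have "\<dots> = x" using z xy by (simp add: act_def)
    finally show ?thesis .
  qed
  then show ?thesis using ij by (intro exI[of _ "j - i"]) auto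
qed

definition period :: nat where
  "period = (SOME m. m > 0 \<and> (\<forall>x\<in>Z. \<forall>y\<in>Z. ((\<lambda>x. op x y) ^^ m) x = x))"

lemma period_pos: "period > 0"
  and funpow_period: "x \<in> Z \<Longrightarrow> y \<in> Z \<Longrightarrow> ((\<lambda>x. op x y) ^^ period) x = x"
  using someI_ex[OF common_period] unfolding period_def by auto

lemma funpow_op_closed: "x \<in> Z \<Longrightarrow> y \<in> Z \<Longrightarrow> ((\<lambda>x. op x y) ^^ n) x \<in> Z"
  by (induction n) auto

section \<open>Central elements\<close>

abbreviation power_word :: "'a \<Rightarrow> 'a list" where
  "power_word y \<equiv> replicate period y"

definition power_words :: "'a list \<Rightarrow> 'a list" where
  "power_words ys = concat (map power_word ys)"

lemma power_words_simps [simp]: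
  "power_words [] = []"
  "power_words (y # ys) = power_word y @ power_words ys"
  "power_words (ys @ ys') = power_words ys @ power_words ys'"
  by (auto simp: power_words_def)

lemma power_word_lists [simp]: "y \<in> Z \<Longrightarrow> replicate n y \<in> lists Z"
  by auto

lemma power_words_lists [simp]: "ys \<in> lists Z \<Longrightarrow> power_words ys \<in> lists Z"
  by (induction ys rule: list.induct) auto

lemma comp_count_power_words [simp]: "comp_count C (power_words ys) = period * comp_count C ys"
  by (induction ys) auto

lemma braid_replicate_right:
  "x \<in> Z \<Longrightarrow> y \<in> Z \<Longrightarrow> [x] @ replicate n y \<approx> replicate n y @ [((\<lambda>x. op x y) ^^ n) x]"
proof (induction n)
  case (Suc n)
  let ?x = "((\<lambda>x. op x y) ^^ n) x"
  have "([x] @ replicate n y) @ [y] \<approx> (replicate n y @ [?x]) @ [y]"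
    using Suc by (intro braid_append_right) auto
  also have "(replicate n y @ [?x]) @ [y] \<approx> replicate n y @ [y, op ?x y] @ []"
    using braid_swap[of "replicate n y" "[]" ?x y] Suc.prems by (simp add: funpow_op_closed)
  finally show ?case by (simp add: replicate_append_same[symmetric])
qed simp

text \<open>In contrast to \<open>braid_replicate_right\<close>, the entry \<open>x\<close> passes
  to the left unchanged and acts on every \<open>y\<close> that it crosses.\<close>

lemma braid_replicate_left:
  "x \<in> Z \<Longrightarrow> y \<in> Z \<Longrightarrow> replicate n y @ [x] \<approx> [x] @ replicate n (op y x)"
proof (induction n)
  case (Suc n)
  have "[y] @ (replicate n y @ [x]) \<approx> [y] @ ([x] @ replicate n (op y x))"
    using Suc by (intro braid_append_left) auto
  also have "[y] @ ([x] @ replicate n (op y x)) \<approx> [x] @ [op y x] @ replicate n (op y x)"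
    using braid_swap[of "[]" "replicate n (op y x)" y x] Suc.prems by simp
  finally show ?case by simp
qed simp

text \<open>Crossing \<open>period\<close> copies of \<open>y\<close> applies a full period of the
  translation by \<open>y\<close> to each entry of \<open>u\<close>, which leaves it
  unchanged.\<close>

lemma power_word_central:
  assumes "y \<in> Z" "u \<in> lists Z"
  shows "u @ power_word y \<approx> power_word y @ u"
  using assms(2)
proof (induction u rule: list.induct)
  case (Cons x u)
  then have x: "x \<in> Z" "u \<in> lists Z" by auto
  have "[x] @ (u @ power_word y) \<approx> [x] @ (power_word y @ u)"
    using Cons x by (intro braid_append_left) auto
  also have "[x] @ (power_word y @ u) \<approx> (power_word y @ [x]) @ u"
    using braid_append[OF braid_replicate_right[of x y period] braid_refl[of u]] x assms
    by (simp add: funpow_period)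
  finally show ?case by simp
qed (use assms in simp)

lemma power_words_central:
  assumes "ys \<in> lists Z" "u \<in> lists Z"
  shows "u @ power_words ys \<approx> power_words ys @ u"
  using assms(1)
proof (induction ys rule: list.induct)
  case (Cons y ys)
  then have y: "y \<in> Z" "ys \<in> lists Z" by auto
  have "(u @ power_word y) @ power_words ys \<approx> (power_word y @ u) @ power_words ys"
    using power_word_central y assms(2) by (intro braid_append_right) auto
  also have "\<dots> = power_word y @ (u @ power_words ys)" by simp
  also have "\<dots> \<approx> power_word y @ (power_words ys @ u)"
    using Cons y by (intro braid_append_left) auto
  finally show ?case by simp
qed (use assms in simp)

lemma braid_to_front:
  assumes "a \<in> lists Z" "y \<in> Z"
  shows "a @ [y] \<approx> [y] @ map (\<lambda>x. op x y) a"
  using assms(1)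
proof (induction a rule: list.induct)
  case (Cons x a)
  then have x: "x \<in> Z" "a \<in> lists Z" by auto
  have m: "map (\<lambda>x. op x y) a \<in> lists Z" using x(2) assms(2) by auto
  have "[x] @ (a @ [y]) \<approx> [x] @ ([y] @ map (\<lambda>x. op x y) a)"
    using Cons x by (intro braid_append_left) auto
  also have "\<dots> \<approx> [y, op x y] @ map (\<lambda>x. op x y) a"
    using braid_swap[of "[]" "map (\<lambda>x. op x y) a" x y] m x assms(2) by simp
  finally show ?case by simp
qed (use assms in simp)

text \<open>With \<open>x\<close> brought to the front of the rest, crossing it turns
  \<open>power_word y\<close> into \<open>power_word (op y x)\<close>, and centrality moves the new
  power back across \<open>x\<close> unchanged.\<close>

lemma power_word_op:
  assumes "y \<in> Z" "u \<in> lists Z" "x \<in> set u"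
  shows "power_word y @ u \<approx> power_word (op y x) @ u"
proof -
  obtain a b where u: "u = a @ x # b" using assms(3) by (auto dest: split_list)
  then have ls: "a \<in> lists Z" "b \<in> lists Z" "x \<in> Z" using assms by auto
  define w where "w = map (\<lambda>z. op z x) a @ b"
  have w: "w \<in> lists Z" using ls by (auto simp: w_def)
  have uw: "u \<approx> [x] @ w"
    using braid_append[OF braid_to_front[OF ls(1,3)] braid_refl[OF ls(2)]] by (simp add: u w_def)
  have "power_word y @ u \<approx> power_word y @ ([x] @ w)"
    using uw assms(1) by (intro braid_append_left) auto
  also have "\<dots> = (power_word y @ [x]) @ w" by simp
  also have "\<dots> \<approx> ([x] @ power_word (op y x)) @ w"
    using braid_replicate_left ls assms(1) w by (intro braid_append_right) auto
  also have "\<dots> \<approx> (power_word (op y x) @ [x]) @ w"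
    using power_word_central[of "op y x" "[x]"] ls assms(1) w by (intro braid_append_right) auto
  also have "\<dots> = power_word (op y x) @ ([x] @ w)" by simp
  also have "\<dots> \<approx> power_word (op y x) @ u"
    using uw ls assms(1) by (intro braid_append_left braid_sym[OF uw]) auto
  finally show ?thesis .
qed

text \<open>In the presence of a generating tuple the central element given by the power of \<open>y\<close>
  depends only on the component of \<open>y\<close>: the \<open>x\<close> for which \<open>y\<close> and \<open>op y x\<close> may be exchanged
  form a subrack.\<close>

lemma power_word_comp:
  assumes u: "u \<in> lists Z" "generates Z op u" and "(y, y') \<in> comp_rel Z op"
  shows "power_word y @ u \<approx> power_word y' @ u"
proof -
  let ?Q = "{(y, y'). y \<in> Z \<and> y' \<in> Z \<and> power_word y @ u \<approx> power_word y' @ u}"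
  let ?T = "{x \<in> Z. \<forall>y\<in>Z. power_word y @ u \<approx> power_word (op y x) @ u}"
  have "?T = Z"
  proof -
    have "op x z \<in> ?T" if "x \<in> ?T" "z \<in> ?T" for x z
    proof -
      have xz: "x \<in> Z" "z \<in> Z" using that by auto
      have "power_word y @ u \<approx> power_word (op y (op x z)) @ u" if y: "y \<in> Z" for y
      proof -
        \<comment> \<open>Writing \<open>y\<close> as \<open>op t z\<close> gives
          \<open>op y (op x z) = op (op t x) z\<close>, so the exchange for \<open>op x z\<close>
          undoes one by \<open>z\<close>, then performs one by \<open>x\<close> and one by
          \<open>z\<close>.\<close>
        obtain t where t: "t \<in> Z" "op t z = y" using op_surj[OF y xz(2)] .
        have "power_word y @ u \<approx> power_word t @ u"
          using \<open>z \<in> ?T\<close> t by (auto intro: braid_sym)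
        also have "\<dots> \<approx> power_word (op t x) @ u" using \<open>x \<in> ?T\<close> t by auto
        also have "\<dots> \<approx> power_word (op (op t x) z) @ u" using \<open>z \<in> ?T\<close> xz t by auto
        also have "op (op t x) z = op y (op x z)" using op_distrib[of x z t] xz t by simp
        finally show ?thesis .
      qed
      then show ?thesis using xz by simp
    qed
    moreover have "set u \<subseteq> ?T" using power_word_op[OF _ u(1)] u(1) by auto
    ultimately show ?thesis by (intro generatesD[OF u(2)]) auto
  qed
  then have T: "power_word y @ u \<approx> power_word (op y x) @ u" if "x \<in> Z" "y \<in> Z" for x y
    using that by blast
  have "comp_rel Z op \<subseteq> ?Q"
    unfolding braid_eq_def
    by (rule comp_least, rule equiv_pullback[OF braid_equiv])
       (use T u(1) in \<open>auto simp: braid_eq_def\<close>)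
  then show ?thesis using assms(3) by auto
qed

text \<open>Entries are exchanged one at a time within their components. The rest of the word
  contains \<open>u\<close> and so generates, as \<open>power_word_comp\<close> requires; centrality
  puts the new power in its place.\<close>

lemma power_words_same_counts:
  assumes ys: "ys \<in> lists Z" "ys' \<in> lists Z"
    and counts: "\<forall>C\<in>triv Z op. comp_count C ys = comp_count C ys'"
    and u: "u \<in> lists Z" "generates Z op u"
  shows "power_words ys @ u \<approx> power_words ys' @ u"
  using ys counts
proof (induction rule: same_counts_induct)
  case Nil
  then show ?case using u by simp
next
  case (Cons y ys y' a b)
  have yy: "y \<in> Z" "y' \<in> Z" using comp_in_Z[OF Cons(1)] by auto
  let ?w = "power_words (a @ b) @ u"
  have w: "?w \<in> lists Z" "generates Z op ?w"
    using Cons u generates_mono[of u ?w] by auto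
  have "power_word y @ (power_words ys @ u) \<approx> power_word y @ ?w"
    using Cons yy by (intro braid_append_left) auto
  also have "\<dots> \<approx> power_word y' @ ?w" by (rule power_word_comp[OF w Cons(1)])
  also have "\<dots> = (power_word y' @ power_words a) @ (power_words b @ u)" by simp
  also have "\<dots> \<approx> (power_words a @ power_word y') @ (power_words b @ u)"
    using Cons yy u power_words_central[of a "power_word y'"] by (intro braid_append_right) auto
  finally show ?case by simp
qed

section \<open>Splitting off central elements\<close>

text \<open>Moving the first occurrence of \<open>y\<close> to the front alters only entries before
  it, none of which is \<open>y\<close>, so each round uses up at most one copy. The strict
  inequality leaves a copy in \<open>u'\<close>.\<close>

lemma braid_extract:
  assumes "y \<in> Z" "u \<in> lists Z" "n < count_list u y"
  shows "\<exists>u'\<in>lists Z. u \<approx> replicate n y @ u' \<and> y \<in> set u'"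
  using assms(2,3)
proof (induction n arbitrary: u)
  case 0
  then have "y \<in> set u" using count_list_0_iff[of u y] by auto
  then show ?case using 0 by (intro bexI[of _ u]) auto
next
  case (Suc n)
  then have "y \<in> set u" using count_list_0_iff[of u y] by auto
  then obtain a b where ab: "u = a @ y # b" "y \<notin> set a" by (auto dest: split_list_first)
  let ?a = "map (\<lambda>x. op x y) a"
  have ls: "a \<in> lists Z" "b \<in> lists Z" using Suc ab by auto
  then have la: "?a @ b \<in> lists Z" using assms(1) by auto
  have "n < count_list (?a @ b) y" using Suc.prems(2) ab by simp
  then obtain u' where u': "u' \<in> lists Z" "?a @ b \<approx> replicate n y @ u'" "y \<in> set u'"
    using Suc.IH[OF la] by blast
  have "u \<approx> [y] @ (?a @ b)"
    using braid_append[OF braid_to_front[OF ls(1) assms(1)] braid_refl[OF ls(2)]] by (simp add: ab)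
  also have "\<dots> \<approx> [y] @ (replicate n y @ u')"
    using u' assms(1) by (intro braid_append_left) auto
  finally show ?case using u' by auto
qed

text \<open>What remains still generates because pigeonhole yields one more copy of \<open>y\<close> than is
  split off.\<close>

lemma split_power_word:
  assumes u: "u \<in> lists Z" "generates Z op u"
    and C: "C \<in> triv Z op" "card Z * period < comp_count C u"
  shows "\<exists>y\<in>C. \<exists>u'\<in>lists Z. generates Z op u' \<and> u \<approx> power_word y @ u'"
proof -
  have CZ: "C \<subseteq> Z" "finite C" using triv_subset[OF C(1)] finite_Z finite_subset by auto
  have "\<exists>y\<in>C. period < count_list u y"
  proof (rule ccontr)
    assume "\<not> ?thesis"
    then have le: "\<And>y. y \<in> C \<Longrightarrow> count_list u y \<le> period" by (meson not_less)
    have "comp_count C u = (\<Sum>y\<in>C. count_list (filter (\<lambda>z. z \<in> C) u) y)"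
      unfolding comp_count_def by (rule sum_count_set[symmetric]) (use CZ in auto)
    also have "\<dots> \<le> (\<Sum>y\<in>C. period)"
    proof (rule sum_mono)
      fix y assume "y \<in> C"
      then have "count_list (filter (\<lambda>z. z \<in> C) u) y = count_list u y"
        by (induction u) auto
      then show "count_list (filter (\<lambda>z. z \<in> C) u) y \<le> period" using le \<open>y \<in> C\<close> by simp
    qed
    also have "\<dots> \<le> card Z * period" using card_mono[OF finite_Z CZ(1)] by simp
    finally show False using C by simp
  qed
  then obtain y where y: "y \<in> C" "period < count_list u y" by blast
  then obtain u' where u': "u' \<in> lists Z" "u \<approx> power_word y @ u'" "y \<in> set u'"
    using braid_extract[of y u period] u CZ by auto
  have "generates Z op (power_word y @ u')" using braid_generates[OF u'(2)] u by simp
  then have "generates Z op u'" using u'(3) by (elim generates_mono[rotated]) auto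
  then show ?thesis using y u' by blast
qed

text \<open>\<open>split_power_word\<close> only yields a power of some \<open>y'\<close> in the
  component of \<open>y\<close>; as the remainder generates, \<open>power_word_comp\<close> trades
  it for the prescribed one. Each split costs \<open>period\<close> entries of one component, so the
  reserve \<open>card Z * period\<close> survives.\<close>

lemma split_power_words:
  assumes "ys \<in> lists Z" "u \<in> lists Z" "generates Z op u"
    and "\<And>C. C \<in> triv Z op \<Longrightarrow> card Z * period + period * comp_count C ys \<le> comp_count C u"
  shows "\<exists>u'\<in>lists Z. generates Z op u' \<and> u \<approx> power_words ys @ u'"
  using assms
proof (induction ys arbitrary: u rule: list.induct)
  case Nil
  then show ?case by (intro bexI[of _ u]) auto
next
  case (Cons y ys)
  let ?C = "comp_rel Z op `` {y}"
  have y: "y \<in> Z" "ys \<in> lists Z" using Cons by auto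
  have C: "?C \<in> triv Z op" "y \<in> ?C" using comp_class_in_triv comp_class_self y by auto
  have "card Z * period < comp_count ?C u"
    using Cons.prems(4)[OF C(1)] C(2) period_pos by simp
  then obtain y' u1 where u1: "y' \<in> ?C" "u1 \<in> lists Z" "generates Z op u1" "u \<approx> power_word y' @ u1"
    using split_power_word[of u ?C] Cons C by blast
  have yy': "(y, y') \<in> comp_rel Z op" using u1(1) by simp
  have "card Z * period + period * comp_count D ys \<le> comp_count D u1" if D: "D \<in> triv Z op" for D
    using Cons.prems(4)[OF D] braid_comp_count[OF u1(4) D] mem_triv_iff[OF D yy']
    by (auto split: if_splits)
  then obtain u2 where u2: "u2 \<in> lists Z" "generates Z op u2" "u1 \<approx> power_words ys @ u2"
    using Cons.IH[of u1] u1 y by blast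
  let ?w = "power_words ys @ u2"
  have w: "?w \<in> lists Z" "generates Z op ?w" using u1 u2 y braid_generates[OF u2(3)] by auto
  have y': "y' \<in> Z" using comp_in_Z[OF yy'] by simp
  have "u \<approx> power_word y' @ u1" by fact
  also have "\<dots> \<approx> power_word y' @ ?w" using u2 y' by (intro braid_append_left) auto
  also have "\<dots> \<approx> power_word y @ ?w" by (rule braid_sym[OF power_word_comp[OF w yy']]) 
  finally show ?case using u2 by auto
qed

section \<open>Cancellation of central elements\<close>

lemma finite_triv: "finite (triv Z op)"
  unfolding triv_def using finite_Z comp_in_Z by (intro finite_quotient) auto

lemma exists_comp_counts: "\<exists>ys\<in>lists Z. \<forall>C\<in>triv Z op. comp_count C ys = d C"
proof -
  have "\<exists>ys\<in>lists Z. \<forall>C\<in>triv Z op. comp_count C ys = (if C \<in> F then d C else 0)"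
    if "finite F" "F \<subseteq> triv Z op" for F
    using that
  proof (induction F rule: finite_induct)
    case empty
    show ?case by (intro bexI[of _ "[]"]) auto
  next
    case (insert D F)
    then obtain ys where ys: "ys \<in> lists Z"
      "\<And>C. C \<in> triv Z op \<Longrightarrow> comp_count C ys = (if C \<in> F then d C else 0)" by auto
    have D: "D \<in> triv Z op" using insert by simp
    then obtain x where x: "x \<in> Z" "D = comp_rel Z op `` {x}"
      unfolding triv_def by (auto elim: quotientE)
    have "x \<in> C \<longleftrightarrow> C = D" if "C \<in> triv Z op" for C
      using triv_class_eq[OF that, of x] comp_class_self[OF x(1)] unfolding x(2) by blast
    then have "comp_count C (replicate (d D) x @ ys) = (if C \<in> insert D F then d C else 0)"
      if "C \<in> triv Z op" for C
      using that ys insert.hyps by auto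
    then show ?case using ys x by (intro bexI[of _ "replicate (d D) x @ ys"]) auto
  qed
  from this[OF finite_triv] show ?thesis by auto
qed

definition orbits :: "'a list \<Rightarrow> 'a list set set" where
  "orbits u = {braid_rel Z op `` {v} | v. v \<in> lists Z \<and> generates Z op v \<and>
     (\<forall>C\<in>triv Z op. comp_count C v = comp_count C u)}"

text \<open>The bound is the reserve of \<open>split_power_words\<close>: for ample
  \<open>u\<close>, a generating tuple with the counts of \<open>power_words s @ u\<close> splits
  off \<open>power_words s\<close>.\<close>

definition ample :: "'a list \<Rightarrow> bool" where
  "ample u \<longleftrightarrow> u \<in> lists Z \<and> generates Z op u \<and>
     (\<forall>C\<in>triv Z op. card Z * period \<le> comp_count C u)"

text \<open>Multiplication by \<open>power_words\<close> preserves the residue, and the restriction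
  to components leaves finitely many values.\<close>

definition residue :: "'a list \<Rightarrow> 'a set \<Rightarrow> nat" where
  "residue u = (\<lambda>C\<in>triv Z op. comp_count C u mod period)"

text \<open>Every entry lies in a component, so the counts determine the length of a tuple.\<close>

lemma finite_orbits:
  assumes "u \<in> lists Z"
  shows "finite (orbits u)"
proof -
  have len: "length v = length u"
    if "v \<in> lists Z" "\<forall>C\<in>triv Z op. comp_count C v = comp_count C u" for v
    using that(1) assms that(2) by (induction rule: same_counts_induct) auto
  have "orbits u \<subseteq> (\<lambda>v. braid_rel Z op `` {v}) ` {v. set v \<subseteq> Z \<and> length v = length u}"
    unfolding orbits_def using len by auto
  then show ?thesis
    by (rule finite_subset) (intro finite_imageI finite_lists_length_eq finite_Z)
qed

text \<open>Multiplication by the central element is surjective onto the orbits with the larger counts;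
  by minimality the target has at least as many elements, so it is injective.\<close>

lemma minimal_cancel:
  assumes u: "ample u"
    and min: "\<And>u'. ample u' \<Longrightarrow> residue u' = residue u \<Longrightarrow> card (orbits u) \<le> card (orbits u')"
    and s: "s \<in> lists Z"
    and v: "v \<in> lists Z" "generates Z op v" "\<forall>C\<in>triv Z op. comp_count C v = comp_count C u"
    and w: "w \<in> lists Z" "generates Z op w" "\<forall>C\<in>triv Z op. comp_count C w = comp_count C u"
    and eq: "power_words s @ v \<approx> power_words s @ w"
  shows "v \<approx> w"
proof -
  let ?cls = "\<lambda>v. braid_rel Z op `` {v}" and ?su = "power_words s @ u"
  \<comment> \<open>Multiplication by \<open>power_words s\<close> on orbits; the next fact shows
    that the chosen representative does not matter.\<close>
  define h where "h A = ?cls (power_words s @ (SOME v. v \<in> A))" for A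
  have h: "h (?cls v) = ?cls (power_words s @ v)" if "v \<in> lists Z" for v
  proof -
    have "v \<in> ?cls v" by (rule equiv_class_self[OF braid_equiv that])
    then have "(SOME v'. v' \<in> ?cls v) \<in> ?cls v" by (rule someI)
    then have "v \<approx> (SOME v'. v' \<in> ?cls v)" by (simp add: braid_eq_def)
    then have "power_words s @ v \<approx> power_words s @ (SOME v'. v' \<in> ?cls v)"
      using s by (intro braid_append_left) auto
    then show ?thesis
      unfolding h_def braid_eq_def by (rule equiv_class_eq[OF braid_equiv, symmetric])
  qed
  have uZ: "u \<in> lists Z" using u by (simp add: ample_def)
  have "orbits ?su \<subseteq> h ` orbits u"
  proof
    fix A assume "A \<in> orbits ?su"
    then obtain z where z: "A = ?cls z" "z \<in> lists Z" "generates Z op z"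
      "\<forall>C\<in>triv Z op. comp_count C z = comp_count C ?su" by (auto simp: orbits_def)
    have "card Z * period + period * comp_count C s \<le> comp_count C z" if "C \<in> triv Z op" for C
      using z(4) u that by (auto simp: ample_def)
    then obtain v where v: "v \<in> lists Z" "generates Z op v" "z \<approx> power_words s @ v"
      using split_power_words[OF s z(2,3)] by blast
    have "\<forall>C\<in>triv Z op. comp_count C v = comp_count C u"
      using z(4) braid_comp_count[OF v(3)] by auto
    then have "?cls v \<in> orbits u" using v by (auto simp: orbits_def)
    moreover have "A = h (?cls v)"
      using v s z by (simp add: h braid_class_eq_iff)
    ultimately show "A \<in> h ` orbits u" by blast
  qed
  then have "card (orbits ?su) \<le> card (h ` orbits u)"
    using finite_orbits[OF uZ] by (intro card_mono) auto
  \<comment> \<open>The target is again ample with the same residue, so minimality of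
    \<open>u\<close> applies to it.\<close>
  moreover have "card (orbits u) \<le> card (orbits ?su)"
  proof (rule min)
    show "ample ?su" using u s generates_mono[of u ?su] by (auto simp: ample_def)
    show "residue ?su = residue u" by (simp add: residue_def cong: restrict_cong)
  qed
  ultimately have "inj_on h (orbits u)"
    using finite_orbits[OF uZ] card_image_le[of "orbits u" h] by (intro eq_card_imp_inj_on) auto
  moreover have "?cls v \<in> orbits u" "?cls w \<in> orbits u" using v w by (auto simp: orbits_def)
  moreover have "h (?cls v) = h (?cls w)"
    using eq v w s by (simp add: h braid_class_eq_iff)
  ultimately have "?cls v = ?cls w" by (meson inj_onD)
  then show ?thesis using v w by (simp add: braid_class_eq_iff)
qed

text \<open>There are finitely many residues, so choosing for each attained one an ample tuple with
  the fewest orbits leaves a common bound on their lengths.\<close>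

lemma minimal_representatives:
  "\<exists>base B. \<forall>v. ample v \<longrightarrow> ample (base (residue v)) \<and> residue (base (residue v)) = residue v \<and>
     length (base (residue v)) \<le> B \<and>
     (\<forall>u. ample u \<and> residue u = residue v \<longrightarrow> card (orbits (base (residue v))) \<le> card (orbits u))"
proof -
  define base where
    "base \<rho> = arg_min (\<lambda>u. card (orbits u)) (\<lambda>u. ample u \<and> residue u = \<rho>)" for \<rho>
  have base: "(ample (base (residue v)) \<and> residue (base (residue v)) = residue v) \<and>
     (\<forall>u. ample u \<and> residue u = residue v \<longrightarrow> card (orbits (base (residue v))) \<le> card (orbits u))"
    if "ample v" for v
    unfolding base_def by (rule arg_min_nat_lemma[of _ v]) (use that in simp)
  have "residue ` {v. ample v} \<subseteq> triv Z op \<rightarrow>\<^sub>E {..<period}"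
    using period_pos by (auto simp: residue_def)
  then have "finite (residue ` {v. ample v})"
    by (rule finite_subset) (auto intro!: finite_PiE finite_triv)
  then have "finite ((\<lambda>\<rho>. length (base \<rho>)) ` residue ` {v. ample v})" by simp
  then obtain B where "\<forall>n\<in>(\<lambda>\<rho>. length (base \<rho>)) ` residue ` {v. ample v}. n \<le> B"
    unfolding finite_nat_set_iff_bounded_le by blast
  then have "length (base (residue v)) \<le> B" if "ample v" for v
    using that by blast
  then show ?thesis using base by blast
qed

text \<open>Both tuples are one common central factor times tuples with the counts of a minimal
  representative; \<open>minimal_cancel\<close> applies to these, and the factor is multiplied
  back.\<close>

theorem eventually_cancellative:
  "\<exists>N0. \<forall>v\<in>lists Z. \<forall>w\<in>lists Z. \<forall>t\<in>lists Z. generates Z op v \<longrightarrow> generates Z op w \<longrightarrow>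
     (\<forall>C\<in>triv Z op. N0 \<le> comp_count C v \<and> comp_count C v = comp_count C w) \<longrightarrow>
     power_words t @ v \<approx> power_words t @ w \<longrightarrow> v \<approx> w"
proof -
  obtain base B where base: "\<And>v. ample v \<Longrightarrow> ample (base (residue v))"
    "\<And>v. ample v \<Longrightarrow> residue (base (residue v)) = residue v"
    "\<And>v. ample v \<Longrightarrow> length (base (residue v)) \<le> B"
    "\<And>u v. ample v \<Longrightarrow> ample u \<Longrightarrow> residue u = residue v \<Longrightarrow>
       card (orbits (base (residue v))) \<le> card (orbits u)"
    using minimal_representatives by blast
  show ?thesis
  \<comment> \<open>The summand \<open>card Z * period\<close> makes \<open>v\<close> ample;
    \<open>B\<close> bounds the length of the minimal representative, whose counts therefore do not
    exceed those of \<open>v\<close>.\<close>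
  proof (intro exI[of _ "B + card Z * period"] ballI impI)
    fix v w t assume ls: "v \<in> lists Z" "w \<in> lists Z" "t \<in> lists Z"
      and gen: "generates Z op v" "generates Z op w"
      and cnt: "\<forall>C\<in>triv Z op. B + card Z * period \<le> comp_count C v \<and> comp_count C v = comp_count C w"
      and eq: "power_words t @ v \<approx> power_words t @ w"
    have v: "ample v" using ls gen cnt by (auto simp: ample_def)
    define u where "u = base (residue v)"
    \<comment> \<open>The number of powers to split off per component to descend from
      \<open>v\<close> to the counts of \<open>u\<close>; on components the division is exact
      because the residues agree.\<close>
    define d where "d C = (comp_count C v - comp_count C u) div period" for C
    have u: "ample u" "residue u = residue v" "length u \<le> B"
      using base v by (auto simp: u_def)
    have d: "comp_count C v = period * d C + comp_count C u" if C: "C \<in> triv Z op" for C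
    proof -
      have "comp_count C u \<le> comp_count C v"
        using comp_count_le_length[of C u] u(3) cnt C by fastforce
      moreover have "comp_count C u mod period = comp_count C v mod period"
        using fun_cong[OF u(2), of C] C by (simp add: residue_def)
      ultimately have "period dvd comp_count C v - comp_count C u"
        by (metis mod_eq_dvd_iff_nat)
      then show ?thesis using \<open>comp_count C u \<le> comp_count C v\<close> by (simp add: d_def)
    qed
    obtain ys where ys: "ys \<in> lists Z" "\<And>C. C \<in> triv Z op \<Longrightarrow> comp_count C ys = d C"
      using exists_comp_counts by blast
    have split: "\<exists>v'\<in>lists Z. generates Z op v' \<and> z \<approx> power_words ys @ v' \<and>
        (\<forall>C\<in>triv Z op. comp_count C v' = comp_count C u)"
      if z: "z \<in> lists Z" "generates Z op z" "\<forall>C\<in>triv Z op. comp_count C z = comp_count C v" for z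
    proof -
      have "card Z * period + period * comp_count C ys \<le> comp_count C z" if "C \<in> triv Z op" for C
        using d[OF that] ys(2)[OF that] z(3) that u(1) by (simp add: ample_def)
      then obtain v' where v': "v' \<in> lists Z" "generates Z op v'" "z \<approx> power_words ys @ v'"
        using split_power_words[OF ys(1) z(1,2)] by blast
      have "comp_count C v' = comp_count C u" if "C \<in> triv Z op" for C
        using d[OF that] ys(2)[OF that] z(3) that braid_comp_count[OF v'(3) that] by simp
      then show ?thesis using v' by blast
    qed
    obtain v' where v': "v' \<in> lists Z" "generates Z op v'" "v \<approx> power_words ys @ v'"
      "\<forall>C\<in>triv Z op. comp_count C v' = comp_count C u"
      using split[of v] ls gen by blast
    obtain w' where w': "w' \<in> lists Z" "generates Z op w'" "w \<approx> power_words ys @ w'"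
      "\<forall>C\<in>triv Z op. comp_count C w' = comp_count C u"
      using split[of w] ls gen cnt by auto
    have t: "power_words t \<in> lists Z" using ls by simp
    have "power_words t @ (power_words ys @ v') \<approx> power_words t @ v"
      by (intro braid_append_left braid_sym[OF v'(3)] t)
    also note eq
    also have "power_words t @ w \<approx> power_words t @ (power_words ys @ w')"
      by (intro braid_append_left w'(3) t)
    finally have "power_words (t @ ys) @ v' \<approx> power_words (t @ ys) @ w'" by simp
    \<comment> \<open>The cancelled factor comprises the given \<open>t\<close> and the
      \<open>ys\<close> split off above.\<close>
    then have "v' \<approx> w'"
      by (intro minimal_cancel[OF u(1) _ _ v'(1,2,4) w'(1,2,4), where s = "t @ ys"])
         (use base(4)[OF v] ls ys u in \<open>auto simp: u_def\<close>)
    then have "power_words ys @ v' \<approx> power_words ys @ w'"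
      using ys by (intro braid_append_left) auto
    then show "v \<approx> w" using v'(3) w'(3) braid_sym braid_trans by blast
  qed
qed

section \<open>Large tuples are determined by their product\<close>

text \<open>Different factors are allowed on the two sides, so the relation sets every central
  \<open>power_words\<close> tuple equal to the identity; in this quotient each entry becomes
  invertible.\<close>

inductive stably_eq :: "'a list \<Rightarrow> 'a list \<Rightarrow> bool" where
  stably_eqI: "\<lbrakk>power_words ys @ u \<approx> power_words ys' @ v; u \<in> lists Z; v \<in> lists Z;
    ys \<in> lists Z; ys' \<in> lists Z\<rbrakk> \<Longrightarrow> stably_eq u v"

inductive_cases stably_eqE: "stably_eq u v"

lemma stably_eq_trans:
  assumes "stably_eq u v" "stably_eq v w"
  shows "stably_eq u w"
proof -
  obtain a b where ab: "power_words a @ u \<approx> power_words b @ v"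
      "u \<in> lists Z" "v \<in> lists Z" "a \<in> lists Z" "b \<in> lists Z"
    using assms(1) by (rule stably_eqE)
  obtain c d where cd: "power_words c @ v \<approx> power_words d @ w"
      "w \<in> lists Z" "c \<in> lists Z" "d \<in> lists Z"
    using assms(2) by (rule stably_eqE)
  have "power_words c @ (power_words a @ u) \<approx> power_words c @ (power_words b @ v)"
    using ab cd by (intro braid_append_left) auto
  also have "\<dots> = (power_words c @ power_words b) @ v" by simp
  \<comment> \<open>Centrality brings \<open>power_words c\<close> next to \<open>v\<close>, where
    the second equation applies.\<close>
  also have "\<dots> \<approx> (power_words b @ power_words c) @ v"
    using ab cd by (intro braid_append_right power_words_central) auto
  also have "\<dots> = power_words b @ (power_words c @ v)" by simp
  also have "\<dots> \<approx> power_words b @ (power_words d @ w)"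
    using ab cd by (intro braid_append_left) auto
  finally have "power_words (c @ a) @ u \<approx> power_words (b @ d) @ w" by simp
  then show ?thesis by (rule stably_eqI) (use ab cd in auto)
qed

lemma stably_eq_equiv: "equiv (lists Z) {(u, v). stably_eq u v}"
proof (rule equivI)
  show "{(u, v). stably_eq u v} \<subseteq> lists Z \<times> lists Z"
    by (auto elim: stably_eqE)
  show "refl_on (lists Z) {(u, v). stably_eq u v}"
    by (rule refl_onI) (simp add: stably_eqI[of "[]" _ "[]"])
  have "stably_eq v u" if "stably_eq u v" for u v
    using that by (rule stably_eqE) (rule stably_eqI[OF braid_sym])
  then show "sym {(u, v). stably_eq u v}" by (simp add: sym_def)
  show "trans {(u, v). stably_eq u v}"
    using stably_eq_trans by (simp add: trans_def)
qed

text \<open>Modulo central elements, \<open>x ^ (period - 1)\<close> is an inverse of \<open>x\<close>.\<close>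

definition positive_tuple :: "('a \<times> bool) list \<Rightarrow> 'a list" where
  "positive_tuple u = concat (map (\<lambda>(x, b). if b then [x] else replicate (period - 1) x) u)"

lemma positive_tuple_simps [simp]:
  "positive_tuple [] = []"
  "positive_tuple ((x, True) # u) = x # positive_tuple u"
  "positive_tuple ((x, False) # u) = replicate (period - 1) x @ positive_tuple u"
  "positive_tuple (u @ v) = positive_tuple u @ positive_tuple v"
  by (auto simp: positive_tuple_def)

lemma positive_tuple_pos_word [simp]: "positive_tuple (pos_word u) = u"
  by (induction u) auto

lemma positive_tuple_lists: "u \<in> words Z \<Longrightarrow> positive_tuple u \<in> lists Z"
  by (induction u) (auto simp: positive_tuple_def split: if_splits)

lemma replicate_pred_append: "replicate (period - Suc 0) x @ [x] = power_word x"
  using period_pos by (simp add: replicate_append_same flip: replicate_Suc)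

text \<open>Each defining relation holds up to one power: a cancelling pair becomes
  \<open>power_word x\<close>, and conjugation becomes a single move behind
  \<open>period - 1\<close> copies of \<open>y\<close>.\<close>

lemma gamma_base_positive_tuple:
  assumes "(a, b) \<in> gamma_base Z op"
  shows "\<exists>s\<in>lists Z. positive_tuple a \<approx> power_words s @ positive_tuple b"
  using assms unfolding gamma_base_def
proof (elim UnE CollectE exE conjE)
  fix x assume x: "(a, b) = ([(x, True), (x, False)], [])" "x \<in> Z"
  then have "positive_tuple a = power_word x"
    using period_pos by (cases period) auto
  then show ?thesis using x by (intro bexI[of _ "[x]"]) auto
next
  fix x assume x: "(a, b) = ([(x, False), (x, True)], [])" "x \<in> Z"
  then have "positive_tuple a = power_word x" by (simp add: replicate_pred_append)
  then show ?thesis using x by (intro bexI[of _ "[x]"]) auto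
next
  fix x y assume x: "(a, b) = ([(y, False), (x, True), (y, True)], [(op x y, True)])" "x \<in> Z" "y \<in> Z"
  have "replicate (period - 1) y @ [x, y] @ [] \<approx> replicate (period - 1) y @ [y, op x y] @ []"
    using x by (intro braid_swap) auto
  also have "\<dots> = power_word y @ [op x y]"
    by (simp flip: replicate_pred_append)
  finally show ?thesis using x by (intro bexI[of _ "[y]"]) auto
qed

text \<open>Modulo central elements the orbit monoid satisfies the relations of the group. As
  \<open>positive_tuple\<close> undoes \<open>pos_word\<close>, equal products of tuples give
  equality up to central factors.\<close>

lemma gamma_imp_stably_eq:
  assumes "u \<simeq> v"
  shows "stably_eq (positive_tuple u) (positive_tuple v)"
proof -
  let ?Q = "{(u, v). u \<in> words Z \<and> v \<in> words Z \<and>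
    (positive_tuple u, positive_tuple v) \<in> {(u, v). stably_eq u v}}"
  have "gamma_rel Z op \<subseteq> ?Q"
  proof (rule gamma_least)
    show "equiv (words Z) ?Q"
      by (rule equiv_pullback[OF stably_eq_equiv]) (use positive_tuple_lists in blast)
    fix u a b v assume ab: "(a, b) \<in> gamma_base Z op" and uv: "u \<in> words Z" "v \<in> words Z"
    let ?u = "positive_tuple u" and ?a = "positive_tuple a"
      and ?b = "positive_tuple b" and ?v = "positive_tuple v"
    have w: "a \<in> words Z" "b \<in> words Z" using gamma_base_words[OF ab] by auto
    have ls: "?u \<in> lists Z" "?a \<in> lists Z" "?b \<in> lists Z" "?v \<in> lists Z"
      using w uv positive_tuple_lists by auto
    obtain s where s: "s \<in> lists Z" "?a \<approx> power_words s @ ?b"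
      using gamma_base_positive_tuple[OF ab] by blast
    have "?u @ ?a @ ?v \<approx> ?u @ (power_words s @ ?b) @ ?v"
      using s ls by (intro braid_context) auto
    also have "\<dots> = (?u @ power_words s) @ (?b @ ?v)" by simp
    also have "\<dots> \<approx> (power_words s @ ?u) @ (?b @ ?v)"
      using s ls by (intro braid_append_right power_words_central) auto
    finally have "power_words [] @ (?u @ ?a @ ?v) \<approx> power_words s @ (?u @ ?b @ ?v)" by simp
    then have "stably_eq (?u @ ?a @ ?v) (?u @ ?b @ ?v)"
      by (rule stably_eqI) (use s ls in auto)
    then show "(u @ a @ v, u @ b @ v) \<in> ?Q" using w uv by simp
  qed
  then show ?thesis using assms by (auto simp: gamma_eq_def)
qed

text \<open>Equal products give equality up to two central factors. Since the tuples have equal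
  counts, so do the factors, which can then be made identical and cancelled.\<close>

theorem eventually_injective:
  "\<exists>N0. \<forall>v\<in>lists Z. \<forall>w\<in>lists Z. generates Z op v \<longrightarrow> generates Z op w \<longrightarrow>
     (\<forall>C\<in>triv Z op. N0 \<le> comp_count C v \<and> comp_count C v = comp_count C w) \<longrightarrow>
     pos_word v \<simeq> pos_word w \<longrightarrow> v \<approx> w"
proof -
  obtain N0 where N0: "\<forall>v\<in>lists Z. \<forall>w\<in>lists Z. \<forall>t\<in>lists Z. generates Z op v \<longrightarrow>
     generates Z op w \<longrightarrow>
     (\<forall>C\<in>triv Z op. N0 \<le> comp_count C v \<and> comp_count C v = comp_count C w) \<longrightarrow>
     power_words t @ v \<approx> power_words t @ w \<longrightarrow> v \<approx> w"
    using eventually_cancellative by (rule exE)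
  show ?thesis
  proof (intro exI[of _ N0] ballI impI)
    fix v w assume ls: "v \<in> lists Z" "w \<in> lists Z" and gen: "generates Z op v" "generates Z op w"
      and cnt: "\<forall>C\<in>triv Z op. N0 \<le> comp_count C v \<and> comp_count C v = comp_count C w"
      and eq: "pos_word v \<simeq> pos_word w"
    have "stably_eq v w" using gamma_imp_stably_eq[OF eq] by simp
    then obtain ys ys' where ys: "ys \<in> lists Z" "ys' \<in> lists Z"
      "power_words ys @ v \<approx> power_words ys' @ w"
      by (rule stably_eqE)
    have "comp_count C ys' = comp_count C ys" if "C \<in> triv Z op" for C
      using braid_comp_count[OF ys(3) that] cnt that period_pos by simp
    then have "power_words ys' @ w \<approx> power_words ys @ w"
      using ys ls gen by (intro power_words_same_counts) auto
    with ys(3) have stable: "power_words ys @ v \<approx> power_words ys @ w" by (rule braid_trans)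
    show "v \<approx> w" by (rule N0[rule_format, OF ls ys(1) gen bspec[OF cnt] stable])
  qed
qed

text \<open>\<open>S_proj\<close> and \<open>count_proj\<close> use the representative chosen by
  \<open>SOME\<close>; generation and counts are orbit invariants and so hold for it too.\<close>

lemma S_star_representative:
  assumes "v \<in> S_star Z op N"
  defines "zs \<equiv> SOME xs. xs \<in> v"
  shows "v = braid_rel Z op `` {zs}" "zs \<in> lists Z" "generates Z op zs"
    "\<forall>C\<in>triv Z op. N \<le> comp_count C zs"
proof -
  obtain us where us: "v = braid_rel Z op `` {us}" "us \<in> lists Z" "generates Z op us"
      "\<forall>C\<in>triv Z op. N \<le> comp_count C us"
    using assms(1) unfolding S_star_def comp_count_def by blast
  have "us \<in> v" unfolding us(1) by (rule equiv_class_self[OF braid_equiv us(2)])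
  then have "zs \<in> v" unfolding zs_def by (rule someI)
  then have eq: "us \<approx> zs" by (simp add: us(1) braid_eq_def)
  show "zs \<in> lists Z" using braid_lists[OF eq] by simp
  then show "v = braid_rel Z op `` {zs}" using eq us braid_class_eq_iff by simp
  show "generates Z op zs" using braid_generates[OF eq] us by simp
  show "\<forall>C\<in>triv Z op. N \<le> comp_count C zs" using braid_comp_count[OF eq] us by simp
qed

end

section \<open>Functoriality\<close>

locale rack_hom = A: rack_structure Z op + B: rack_structure W opW
  for Z :: "'a set" and op and W :: "'b set" and opW +
  fixes h :: "'a \<Rightarrow> 'b"
  assumes h_closed: "x \<in> Z \<Longrightarrow> h x \<in> W"
    and h_op: "x \<in> Z \<Longrightarrow> y \<in> Z \<Longrightarrow> h (op x y) = opW (h x) (h y)"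
begin

lemma comp_hom:
  assumes "(x, y) \<in> comp_rel Z op"
  shows "(h x, h y) \<in> comp_rel W opW"
proof -
  have "comp_rel Z op \<subseteq> {(x, y). x \<in> Z \<and> y \<in> Z \<and> (h x, h y) \<in> comp_rel W opW}"
    by (rule A.comp_least, rule equiv_pullback[OF B.comp_equiv])
       (use h_closed B.comp_op in \<open>auto simp: h_op\<close>)
  then show ?thesis using assms by auto
qed

definition map_word :: "('a \<times> bool) list \<Rightarrow> ('b \<times> bool) list" where
  "map_word u = map (\<lambda>l. (h (fst l), snd l)) u"

lemma map_word_simps [simp]:
  "map_word [] = []"
  "map_word (l # u) = (h (fst l), snd l) # map_word u"
  "map_word (u @ v) = map_word u @ map_word v"
  "map_word (A.pos_word zs) = B.pos_word (map h zs)"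
  "map_word (A.inv_word u) = B.inv_word (map_word u)"
  by (auto simp: map_word_def A.pos_word_def B.pos_word_def A.inv_word_def B.inv_word_def rev_map)

lemma map_word_words: "u \<in> words Z \<Longrightarrow> map_word u \<in> words W"
  by (induction u) (auto simp: h_closed)

lemma map_word_cong:
  assumes "A.gamma_eq u v"
  shows "B.gamma_eq (map_word u) (map_word v)"
proof -
  let ?Q = "{(u, v). u \<in> words Z \<and> v \<in> words Z \<and> (map_word u, map_word v) \<in> gamma_rel W opW}"
  have "gamma_rel Z op \<subseteq> ?Q"
  proof (rule A.gamma_least)
    show "equiv (words Z) ?Q"
      by (rule equiv_pullback[OF B.gamma_equiv]) (use map_word_words in blast)
    fix u a b v assume z: "(a, b) \<in> gamma_base Z op" "u \<in> words Z" "v \<in> words Z"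
    have "(map_word a, map_word b) \<in> gamma_base W opW"
      using z(1) unfolding gamma_base_def
      by (elim UnE CollectE exE conjE) (auto simp: h_closed h_op)
    then have "B.gamma_eq (map_word u @ map_word a @ map_word v) (map_word u @ map_word b @ map_word v)"
      using z by (intro B.gamma_step map_word_words)
    then show "(u @ a @ v, u @ b @ v) \<in> ?Q"
      using z A.gamma_base_words[OF z(1)] by (simp add: B.gamma_eq_def)
  qed
  then show ?thesis using assms by (auto simp: A.gamma_eq_def B.gamma_eq_def)
qed

lemma gamma_map_class:
  assumes "u \<in> words Z"
  shows "gamma_map W opW h (A.gamma_class u) = B.gamma_class (map_word u)"
proof -
  have "B.gamma_eq (map_word u) (map_word (SOME v. v \<in> A.gamma_class u))"
    by (rule map_word_cong[OF A.gamma_class_some[OF assms]])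
  then show ?thesis
    unfolding gamma_map_def B.gamma_eq_def map_word_def
    by (rule equiv_class_eq[OF B.gamma_equiv, symmetric])
qed

text \<open>Tuples in one orbit have equal products, so the quotient is trivial in the target. The
  identity appears as the image of \<open>gamma_class []\<close>, the form in which injectivity is
  applied.\<close>

lemma gamma_map_eq_one:
  assumes "zs \<in> lists Z" "ws \<in> lists Z"
    and "braid_rel W opW `` {map h zs} = braid_rel W opW `` {map h ws}"
  shows "gamma_map W opW h (A.gamma_class (A.pos_word zs @ A.inv_word (A.pos_word ws))) =
    gamma_map W opW h (A.gamma_class [])"
proof -
  have ls: "map h zs \<in> lists W" "map h ws \<in> lists W" using assms(1,2) h_closed by auto
  have "B.braid_eq (map h zs) (map h ws)"
    using assms(3) by (simp only: B.braid_class_eq_iff[OF ls])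
  then have "B.gamma_eq (B.pos_word (map h zs)) (B.pos_word (map h ws))"
    by (rule B.braid_imp_gamma)
  then have "B.gamma_eq (B.pos_word (map h zs) @ B.inv_word (B.pos_word (map h ws)))
      (B.pos_word (map h ws) @ B.inv_word (B.pos_word (map h ws)))"
    using ls by (intro B.gamma_append B.gamma_refl) auto
  also have "B.gamma_eq \<dots> []"
    using ls by (intro B.append_inv_word) simp
  finally show ?thesis
    using assms(1,2) ls by (simp add: gamma_map_class B.gamma_class_eq_iff)
qed

end

section \<open>Products of racks, synchronization and the final comparison\<close>

lemma rack_prod:
  assumes "rack X opX" "rack Y opY"
  shows "rack (X \<times> Y) (prod_op opX opY)"
proof -
  interpret X: rack_structure X opX by unfold_locales fact
  interpret Y: rack_structure Y opY by unfold_locales fact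
  have bij: "bij_betw (\<lambda>p. prod_op opX opY p q) (X \<times> Y) (X \<times> Y)" if q: "q \<in> X \<times> Y" for q
  proof -
    have "inj_on (\<lambda>x. opX x (fst q)) X" "(\<lambda>x. opX x (fst q)) ` X = X"
      "inj_on (\<lambda>y. opY y (snd q)) Y" "(\<lambda>y. opY y (snd q)) ` Y = Y"
      using X.op_bij Y.op_bij q by (auto simp: bij_betw_def)
    moreover have "(\<lambda>p. prod_op opX opY p q) = map_prod (\<lambda>x. opX x (fst q)) (\<lambda>y. opY y (snd q))"
      by (auto simp: prod_op_def)
    ultimately show ?thesis
      by (simp add: bij_betw_def map_prod_inj_on map_prod_surj_on)
  qed
  have distrib: "prod_op opX opY (prod_op opX opY r p) q =
      prod_op opX opY (prod_op opX opY r q) (prod_op opX opY p q)"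
    if "p \<in> X \<times> Y" "q \<in> X \<times> Y" "r \<in> X \<times> Y" for p q r
    using X.op_distrib[of "fst p" "fst q" "fst r"] Y.op_distrib[of "snd p" "snd q" "snd r"] that
    by (auto simp: prod_op_def)
  have closed: "prod_op opX opY p q \<in> X \<times> Y" if "p \<in> X \<times> Y" "q \<in> X \<times> Y" for p q
    using that by (auto simp: prod_op_def)
  show ?thesis unfolding rack_def by (intro conjI ballI closed bij distrib)
qed

text \<open>One direction is functoriality of components, the other injectivity of
  \<open>triv_map\<close>. This turns condition (iii) into equality of counts over components of the
  product.\<close>

lemma synchronized_component:
  assumes "rack X opX" "rack Y opY" "synchronized X opX Y opY"
    and C: "C \<in> triv (X \<times> Y) (prod_op opX opY)" and z: "z \<in> X \<times> Y"
  shows "z \<in> C \<longleftrightarrow> (comp_rel X opX `` {fst z}, comp_rel Y opY `` {snd z}) = triv_map X opX Y opY C"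
proof -
  interpret X: rack_structure X opX by unfold_locales fact
  interpret Y: rack_structure Y opY by unfold_locales fact
  interpret Z: rack_structure "X \<times> Y" "prod_op opX opY"
    by unfold_locales (rule rack_prod[OF assms(1,2)])
  interpret FX: rack_hom "X \<times> Y" "prod_op opX opY" X opX fst
    by unfold_locales (auto simp: prod_op_def)
  interpret FY: rack_hom "X \<times> Y" "prod_op opX opY" Y opY snd
    by unfold_locales (auto simp: prod_op_def)
  have forward: "(comp_rel X opX `` {fst z}, comp_rel Y opY `` {snd z}) = triv_map X opX Y opY D"
    if D: "D \<in> triv (X \<times> Y) (prod_op opX opY)" "z \<in> D" for D
  proof -
    have "(SOME p. p \<in> D) \<in> D" using D(2) by (rule someI)
    then have r: "(z, SOME p. p \<in> D) \<in> comp_rel (X \<times> Y) (prod_op opX opY)"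
      using Z.triv_class_eq[OF D] by blast
    show ?thesis
      using equiv_class_eq[OF X.comp_equiv FX.comp_hom[OF r]]
        equiv_class_eq[OF Y.comp_equiv FY.comp_hom[OF r]]
      by (simp add: triv_map_def)
  qed
  show ?thesis
  proof
    assume "(comp_rel X opX `` {fst z}, comp_rel Y opY `` {snd z}) = triv_map X opX Y opY C"
    moreover let ?D = "comp_rel (X \<times> Y) (prod_op opX opY) `` {z}"
    have D: "?D \<in> triv (X \<times> Y) (prod_op opX opY)" "z \<in> ?D"
      using Z.comp_class_in_triv Z.comp_class_self z by auto
    ultimately have "triv_map X opX Y opY ?D = triv_map X opX Y opY C"
      using forward[OF D] by simp
    then have "?D = C"
      using assms(3) C D(1) unfolding synchronized_def bij_betw_def by (meson inj_onD)
    then show "z \<in> C" using D(2) by simp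
  qed (rule forward[OF C])
qed

theorem theorem4p30:
  fixes X :: "'a set" and opX :: "'a \<Rightarrow> 'a \<Rightarrow> 'a"
    and Y :: "'b set" and opY :: "'b \<Rightarrow> 'b \<Rightarrow> 'b"
  assumes "rack X opX" and "rack Y opY"
    and "finite X" and "finite Y"
    and "productive X opX Y opY" and "synchronized X opX Y opY"
  shows "\<exists>N0. \<forall>N\<ge>N0. \<forall>v \<in> S_star (X \<times> Y) (prod_op opX opY) N.
           \<forall>w \<in> S_star (X \<times> Y) (prod_op opX opY) N.
             S_proj X opX fst v = S_proj X opX fst w \<and>
             S_proj Y opY snd v = S_proj Y opY snd w \<and>
             (\<forall>t \<in> triv X opX \<times> triv Y opY.
                count_proj X opX Y opY v t = count_proj X opX Y opY w t)
             \<longrightarrow> v = w"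
proof -
  let ?Z = "X \<times> Y" and ?op = "prod_op opX opY"
  interpret X: rack_structure X opX by unfold_locales fact
  interpret Y: rack_structure Y opY by unfold_locales fact
  interpret Z: finite_rack ?Z ?op
    by unfold_locales (use rack_prod assms in auto)
  interpret FX: rack_hom ?Z ?op X opX fst
    by unfold_locales (auto simp: prod_op_def)
  interpret FY: rack_hom ?Z ?op Y opY snd
    by unfold_locales (auto simp: prod_op_def)
  interpret G: group "Gamma ?Z ?op" by (rule Z.Gamma_group)
  let ?D = "derived (Gamma ?Z ?op) (carrier (Gamma ?Z ?op))"
  obtain N0 where N0: "\<forall>v\<in>lists ?Z. \<forall>w\<in>lists ?Z. generates ?Z ?op v \<longrightarrow> generates ?Z ?op w \<longrightarrow>
     (\<forall>C\<in>triv ?Z ?op. N0 \<le> Z.comp_count C v \<and> Z.comp_count C v = Z.comp_count C w) \<longrightarrow>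
     Z.gamma_eq (Z.pos_word v) (Z.pos_word w) \<longrightarrow> Z.braid_eq v w"
    using Z.eventually_injective by (rule exE)
  show ?thesis
  proof (intro exI[of _ N0] allI impI ballI, elim conjE)
    fix N v w
    assume N: "N0 \<le> N" and v: "v \<in> S_star ?Z ?op N" and w: "w \<in> S_star ?Z ?op N"
      and projX: "S_proj X opX fst v = S_proj X opX fst w"
      and projY: "S_proj Y opY snd v = S_proj Y opY snd w"
      and cnt: "\<forall>t\<in>triv X opX \<times> triv Y opY.
        count_proj X opX Y opY v t = count_proj X opX Y opY w t"
    define zs where "zs = (SOME xs. xs \<in> v)"
    define ws where "ws = (SOME xs. xs \<in> w)"
    note zs = Z.S_star_representative[OF v, folded zs_def]
    note ws = Z.S_star_representative[OF w, folded ws_def]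
    have count: "Z.comp_count C zs = Z.comp_count C ws" if C: "C \<in> triv ?Z ?op" for C
    proof -
      have "Z.comp_count C us = length (filter (\<lambda>z. (comp_rel X opX `` {fst z},
          comp_rel Y opY `` {snd z}) = triv_map X opX Y opY C) us)" if "us \<in> lists ?Z" for us
        unfolding Z.comp_count_def
        by (intro arg_cong[of _ _ length] filter_cong refl)
           (use that synchronized_component[OF assms(1,2,6) C] in auto)
      then have "Z.comp_count C zs = count_proj X opX Y opY v (triv_map X opX Y opY C)"
        "Z.comp_count C ws = count_proj X opX Y opY w (triv_map X opX Y opY C)"
        using zs ws by (simp_all add: count_proj_def zs_def ws_def)
      moreover have "triv_map X opX Y opY C \<in> triv X opX \<times> triv Y opY"
        using assms(6) C unfolding synchronized_def by (rule bij_betw_apply)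
      ultimately show ?thesis using cnt by simp
    qed
    \<comment> \<open>The quotient of the two products: equal counts put it into the derived
      subgroup, where productivity compares it with the identity.\<close>
    let ?u = "Z.pos_word zs @ Z.inv_word (Z.pos_word ws)"
    have "Z.gamma_class ?u = Z.gamma_class []"
    proof (rule inj_onD[OF assms(5)[unfolded productive_def Let_def]])
      show "Z.gamma_class ?u \<in> ?D"
        using zs ws count by (intro Z.same_counts_derived) auto
      show "Z.gamma_class [] \<in> ?D"
        using subgroup.one_closed[OF G.derived_is_subgroup[OF subset_refl]] by (simp add: Z.Gamma_one)
      have "gamma_map X opX fst (Z.gamma_class ?u) = gamma_map X opX fst (Z.gamma_class [])"
        by (rule FX.gamma_map_eq_one)
           (use zs ws projX in \<open>simp_all add: S_proj_def zs_def ws_def\<close>)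
      moreover have "gamma_map Y opY snd (Z.gamma_class ?u) = gamma_map Y opY snd (Z.gamma_class [])"
        by (rule FY.gamma_map_eq_one)
           (use zs ws projY in \<open>simp_all add: S_proj_def zs_def ws_def\<close>)
      ultimately show "(gamma_map X opX fst (Z.gamma_class ?u), gamma_map Y opY snd (Z.gamma_class ?u)) =
          (gamma_map X opX fst (Z.gamma_class []), gamma_map Y opY snd (Z.gamma_class []))"
        by simp
    qed
    then have one: "Z.gamma_eq ?u []"
      using zs ws by (simp add: Z.gamma_class_eq_iff)
    have "Z.gamma_eq (Z.pos_word zs @ [])
        (Z.pos_word zs @ (Z.inv_word (Z.pos_word ws) @ Z.pos_word ws))"
      using zs ws by (intro Z.gamma_append Z.gamma_refl Z.gamma_sym[OF Z.inv_word_append]) auto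
    also have "\<dots> = ?u @ Z.pos_word ws" by simp
    also have "Z.gamma_eq \<dots> ([] @ Z.pos_word ws)"
      using ws by (intro Z.gamma_append Z.gamma_refl one) auto
    finally have "Z.gamma_eq (Z.pos_word zs) (Z.pos_word ws)" by simp
    moreover have "N0 \<le> Z.comp_count C zs \<and> Z.comp_count C zs = Z.comp_count C ws"
      if "C \<in> triv ?Z ?op" for C
      using zs(4) count N that by (meson order_trans)
    ultimately have "Z.braid_eq zs ws"
      by (intro N0[rule_format, OF zs(2) ws(2) zs(3) ws(3)])
    then show "v = w"
      using zs ws Z.braid_class_eq_iff by simp
  qed
qed

end
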